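(* Let $T>0$ and let $B^{\mathcal H}_\alpha$ be the Hadamard fractional Brownian motion with $\alpha\in(1,2)$. Then, for $p>0$, the $p$-variation $V^p(B^{\mathcal H}_\alpha,[0,T])$ is finite and non-zero for $p=\frac2\alpha$, zero for $p>\frac2\alpha$, and infinite for $p<\frac2\alpha$. In particular, the quadratic variation $V^2(B^{\mathcal H}_\alpha,[0,T])$ is zero.
   Context: Let $B=\{B(t)\}_{t\ge0}$ be a standard Brownian motion. For $\alpha>0$ the Hadamard fractional Brownian motion is the centered Gaussian process $B^{\mathcal H}_\alpha=\{B^{\mathcal H}_\alpha(t)\}_{t\ge 0}$ given by $B^{\mathcal H}_\alpha(0)=0$ and the Wiener integral $$B^{\mathcal H}_\alpha(t)=\frac1{\sqrt{\Gamma(\alpha)}}\int_0^t\Big(\log\frac ts\Big)^{(\alpha-1)/2}dB(s),\qquad t>0.$$ For a process $X$ and $p>0$, the $p$-variation on $[0,T]$ is the limit $$V^p(X,[0,T])=\lim_{n\to\infty}\mathbb E\sum_{k=1}^n\left|X\Big(\frac{Tk}{n}\Big)-X\Big(\frac{T(k-1)}{n}\Big)\right|^p\in[0,\infty];$$ the assertion that the $p$-variation is finite non-zero, zero or infinite includes the existence of this limit. *)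

theory Defs
  imports "HOL-Probability.Probability"
begin

text \<open>
  Processes indexed by the half-line have type \<open>real \<Rightarrow> 'a \<Rightarrow> real\<close> (time, then outcome); their
  values at negative times are irrelevant and never constrained.
\<close>

locale standard_brownian_motion = prob_space M for M :: "'a measure" +
  fixes B :: "real \<Rightarrow> 'a \<Rightarrow> real"
  assumes B_measurable: "\<And>t. 0 \<le> t \<Longrightarrow> B t \<in> borel_measurable M"
    and B_zero: "AE \<omega> in M. B 0 \<omega> = 0"
    and B_indep_increments:
      "\<And>(n::nat) (t::nat \<Rightarrow> real). 0 \<le> t 0 \<Longrightarrow> (\<And>i. i < n \<Longrightarrow> t i \<le> t (Suc i)) \<Longrightarrow>
         indep_vars (\<lambda>_. borel) (\<lambda>i \<omega>. B (t (Suc i)) \<omega> - B (t i) \<omega>) {..<n}"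
    and B_normal_increments:
      "\<And>s t. 0 \<le> s \<Longrightarrow> s < t \<Longrightarrow>
         distributed M lborel (\<lambda>\<omega>. B t \<omega> - B s \<omega>) (normal_density 0 (sqrt (t - s)))"
    and B_continuous_paths: "AE \<omega> in M. continuous_on {0..} (\<lambda>t. B t \<omega>)"

text \<open>
  A list of triples \<open>(c, a, b)\<close> with \<open>0 \<le> a \<le> b\<close> encodes the step function that is the sum of
  the functions \<open>c * indicator {a<..b}\<close>. The intervals may overlap.
\<close>

definition step_list :: "(real \<times> real \<times> real) list \<Rightarrow> bool" where
  "step_list xs \<longleftrightarrow> (\<forall>(c, a, b) \<in> set xs. 0 \<le> a \<and> a \<le> b)"

definition step_fun :: "(real \<times> real \<times> real) list \<Rightarrow> real \<Rightarrow> real" where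
  "step_fun xs s = (\<Sum>(c, a, b)\<leftarrow>xs. c * indicator {a<..b} s)"

definition step_integral ::
    "(real \<Rightarrow> 'a \<Rightarrow> real) \<Rightarrow> (real \<times> real \<times> real) list \<Rightarrow> 'a \<Rightarrow> real" where
  "step_integral B xs \<omega> = (\<Sum>(c, a, b)\<leftarrow>xs. c * (B b \<omega> - B a \<omega>))"

text \<open>
  \<open>I\<close> is (a version of) the Wiener integral of the deterministic \<open>f\<close> over the half-line: the
  \<open>L\<^sup>2(M)\<close>-limit of the integrals of step functions that approximate \<open>f\<close> in \<open>L\<^sup>2([0,\<infinity>))\<close>. By the
  Ito isometry such an \<open>I\<close> exists for every square integrable \<open>f\<close> and does not depend, up to
  null sets, on the approximating sequence. The integral over an interval is obtained by
  multiplying \<open>f\<close> with an indicator function.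
\<close>

definition has_wiener_integral ::
    "'a measure \<Rightarrow> (real \<Rightarrow> 'a \<Rightarrow> real) \<Rightarrow> (real \<Rightarrow> real) \<Rightarrow> ('a \<Rightarrow> real) \<Rightarrow> bool" where
  "has_wiener_integral M B f I \<longleftrightarrow>
     f \<in> borel_measurable borel \<and> I \<in> borel_measurable M \<and>
     (\<exists>xs :: nat \<Rightarrow> (real \<times> real \<times> real) list.
        (\<forall>n. step_list (xs n)) \<and>
        (\<lambda>n. \<integral>\<^sup>+s\<in>{0..}. ennreal ((f s - step_fun (xs n) s)\<^sup>2) \<partial>lborel) \<longlonglongrightarrow> 0 \<and>
        (\<lambda>n. \<integral>\<^sup>+\<omega>. ennreal ((I \<omega> - step_integral B (xs n) \<omega>)\<^sup>2) \<partial>M) \<longlonglongrightarrow> 0)"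

definition hadamard_kernel :: "real \<Rightarrow> real \<Rightarrow> real \<Rightarrow> real" where
  "hadamard_kernel \<alpha> t s = indicator {0<..<t} s * (ln (t / s)) powr ((\<alpha> - 1) / 2)"

text \<open>
  \<open>X\<close> is a version of the Hadamard fractional Brownian motion driven by \<open>B\<close> (meant for
  \<open>\<alpha> > 0\<close>). As Wiener integrals are determined only up to null sets, so is each \<open>X t\<close>. That
  \<open>X\<close> is centered and Gaussian is a consequence and hence not part of the definition.
\<close>

definition hadamard_fbm ::
    "'a measure \<Rightarrow> (real \<Rightarrow> 'a \<Rightarrow> real) \<Rightarrow> real \<Rightarrow> (real \<Rightarrow> 'a \<Rightarrow> real) \<Rightarrow> bool" where
  "hadamard_fbm M B \<alpha> X \<longleftrightarrow>
     (\<forall>\<omega>\<in>space M. X 0 \<omega> = 0) \<and>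
     (\<forall>t>0. \<exists>I. has_wiener_integral M B (hadamard_kernel \<alpha> t) I \<and>
                (\<forall>\<omega>\<in>space M. X t \<omega> = 1 / sqrt (Gamma \<alpha>) * I \<omega>))"

text \<open>
  The \<open>p\<close>-variation of \<open>X\<close> on \<open>[0,T]\<close> exists as a limit in \<open>[0,\<infinity>]\<close> and equals \<open>v\<close>. The
  expectation of the nonnegative sum is likewise taken in \<open>[0,\<infinity>]\<close>.
\<close>

definition has_p_variation ::
    "'a measure \<Rightarrow> (real \<Rightarrow> 'a \<Rightarrow> real) \<Rightarrow> real \<Rightarrow> real \<Rightarrow> ennreal \<Rightarrow> bool" where
  "has_p_variation M X p T v \<longleftrightarrow>
     (\<lambda>n. \<integral>\<^sup>+\<omega>. ennreal (\<Sum>k = 1..n.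
            \<bar>X (T * real k / real n) \<omega> - X (T * (real k - 1) / real n) \<omega>\<bar> powr p) \<partial>M)
     \<longlonglongrightarrow> v"

end

theory Submission
  imports Defs "HOL-Real_Asymp.Real_Asymp"
begin

text \<open>
  Since \<open>X\<close> is built from Wiener integrals of a deterministic kernel, every increment
  \<open>X t - X s\<close> is a centered normal variable, so its absolute moment of order \<open>p\<close> is a universal
  positive constant times the power \<open>p / 2\<close> of its variance (\<open>wiener_integral_abs_moment\<close>). Normality
  is read off characteristic functions: for step functions it follows from the independence
  of the Brownian increments, and \<open>L\<^sup>2\<close> limits preserve it (\<open>wiener_integral_gaussian\<close>).

  The variance of an increment is the squared \<open>L\<^sup>2\<close> norm of a difference of kernels. The kernel
  depends on \<open>t / s\<close> only, hence the increment over the \<open>k\<close>-th of \<open>n\<close> intervals has variance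
  \<open>T / (n * Gamma \<alpha>) * D k\<close>, where \<open>D k\<close> belongs to the time interval from \<open>k - 1\<close> to \<open>k\<close>. Far from the
  origin the increments look like those of a multiple of fractional Brownian motion of Hurst index
  \<open>\<alpha> / 2\<close>: put \<open>b = (\<alpha> - 1) / 2\<close> and place the origin at the right end point. Then
  \<open>k * ln (k / (k - x))\<close> tends to \<open>x\<close>, so \<open>k powr b\<close> times the kernel difference tends to
  \<open>max 0 x powr b - max 0 (x - 1) powr b\<close>, the kernel of a unit increment of fractional Brownian motion.
  Dominated convergence gives \<open>k powr (\<alpha> - 1) * D k \<longlonglongrightarrow> C\<close> with \<open>0 < C\<close>
  (\<open>hadamard_increment_L2_asymptotics\<close>).

  It remains to study \<open>\<Sum>k=1..n. (D k / n) powr (p / 2)\<close>. For \<open>p = 2 / \<alpha>\<close> the summands behave like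
  \<open>C powr (1 / \<alpha>) * k powr (1 / \<alpha> - 1) / n powr (1 / \<alpha>)\<close>, and the sum tends to
  \<open>\<alpha> * C powr (1 / \<alpha>)\<close> by the Stolz-Cesaro theorem (\<open>critical_power_sum\<close>). As \<open>D\<close> is bounded, each
  \<open>D k / n\<close> is at most of order \<open>1 / n\<close>; changing the exponent away from the critical one multiplies
  the sum by a factor that tends to zero or to infinity (\<open>noncritical_power_sum\<close>).
\<close>

section \<open>Convergence in the quadratic mean\<close>

lemma L2_null_sequence:
  fixes h :: "nat \<Rightarrow> 'b \<Rightarrow> real"
  assumes [measurable]: "\<And>n. h n \<in> borel_measurable N"
    and lim: "(\<lambda>n. \<integral>\<^sup>+x. ennreal ((h n x)\<^sup>2) \<partial>N) \<longlonglongrightarrow> 0"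
  shows "\<forall>\<^sub>F n in sequentially. integrable N (\<lambda>x. (h n x)\<^sup>2)"
    and "(\<lambda>n. \<integral>x. (h n x)\<^sup>2 \<partial>N) \<longlonglongrightarrow> 0"
proof -
  have "\<forall>\<^sub>F n in sequentially. (\<integral>\<^sup>+x. ennreal ((h n x)\<^sup>2) \<partial>N) < 1"
    by (rule order_tendstoD(2)[OF lim]) simp
  then show "\<forall>\<^sub>F n in sequentially. integrable N (\<lambda>x. (h n x)\<^sup>2)"
  proof eventually_elim
    case (elim n)
    then have "(\<integral>\<^sup>+x. ennreal ((h n x)\<^sup>2) \<partial>N) < \<infinity>"
      by (rule order.strict_trans) simp
    then show ?case by (intro integrableI_nonneg) auto
  qed
  have "(\<integral>x. (h n x)\<^sup>2 \<partial>N) = enn2real (\<integral>\<^sup>+x. ennreal ((h n x)\<^sup>2) \<partial>N)" for n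
    by (intro integral_eq_nn_integral) auto
  with tendsto_enn2real[OF lim[folded ennreal_0]]
  show "(\<lambda>n. \<integral>x. (h n x)\<^sup>2 \<partial>N) \<longlonglongrightarrow> 0" by simp
qed

text \<open>
  The real-valued form of the inequality for nonnegative integrals, with the integrability that
  is needed to split integrals of products.
\<close>

lemma Cauchy_Schwarz_integral:
  fixes f g :: "'b \<Rightarrow> real"
  assumes [measurable]: "f \<in> borel_measurable N" "g \<in> borel_measurable N"
    and f: "integrable N (\<lambda>x. (f x)\<^sup>2)" and g: "integrable N (\<lambda>x. (g x)\<^sup>2)"
  shows "integrable N (\<lambda>x. f x * g x)"
    and "(\<integral>x. \<bar>f x * g x\<bar> \<partial>N)\<^sup>2 \<le> (\<integral>x. (f x)\<^sup>2 \<partial>N) * (\<integral>x. (g x)\<^sup>2 \<partial>N)"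
proof -
  have "\<bar>f x * g x\<bar> \<le> (f x)\<^sup>2 + (g x)\<^sup>2" for x
    using zero_le_power2[of "\<bar>f x\<bar> - \<bar>g x\<bar>"] mult_nonneg_nonneg[OF abs_ge_zero abs_ge_zero, of "f x" "g x"]
    unfolding power2_diff power2_abs abs_mult by linarith
  then show int: "integrable N (\<lambda>x. f x * g x)"
    using f g by (intro Bochner_Integration.integrable_bound[OF Bochner_Integration.integrable_add[OF f g]]) auto
  have "(\<integral>\<^sup>+x. ennreal \<bar>f x\<bar> * ennreal \<bar>g x\<bar> \<partial>N)\<^sup>2
      \<le> (\<integral>\<^sup>+x. (ennreal \<bar>f x\<bar>)\<^sup>2 \<partial>N) * (\<integral>\<^sup>+x. (ennreal \<bar>g x\<bar>)\<^sup>2 \<partial>N)"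
    by (rule Cauchy_Schwarz_nn_integral) auto
  moreover have "(\<integral>\<^sup>+x. ennreal \<bar>f x\<bar> * ennreal \<bar>g x\<bar> \<partial>N) = ennreal (\<integral>x. \<bar>f x * g x\<bar> \<partial>N)"
    using integrable_abs[OF int] by (subst nn_integral_eq_integral[symmetric]) (auto simp: ennreal_mult abs_mult)
  ultimately have "ennreal ((\<integral>x. \<bar>f x * g x\<bar> \<partial>N)\<^sup>2)
      \<le> ennreal ((\<integral>x. (f x)\<^sup>2 \<partial>N) * (\<integral>x. (g x)\<^sup>2 \<partial>N))"
    by (simp add: ennreal_power nn_integral_eq_integral[OF f] nn_integral_eq_integral[OF g] ennreal_mult)
  then show "(\<integral>x. \<bar>f x * g x\<bar> \<partial>N)\<^sup>2 \<le> (\<integral>x. (f x)\<^sup>2 \<partial>N) * (\<integral>x. (g x)\<^sup>2 \<partial>N)"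
    by (simp add: ennreal_le_iff)
qed

lemma L2_pairing_tendsto_0:
  fixes f :: "'b \<Rightarrow> real" and e :: "nat \<Rightarrow> 'b \<Rightarrow> real"
  assumes [measurable]: "f \<in> borel_measurable N" "\<And>n. e n \<in> borel_measurable N"
    and f: "integrable N (\<lambda>x. (f x)\<^sup>2)"
    and lim: "(\<lambda>n. \<integral>\<^sup>+x. ennreal ((e n x)\<^sup>2) \<partial>N) \<longlonglongrightarrow> 0"
  shows "(\<lambda>n. \<integral>x. \<bar>f x * e n x\<bar> \<partial>N) \<longlonglongrightarrow> 0"
proof -
  note e = L2_null_sequence[OF assms(2) lim]
  have "(\<lambda>n. (\<integral>x. \<bar>f x * e n x\<bar> \<partial>N)\<^sup>2) \<longlonglongrightarrow> 0"
  proof (rule tendsto_sandwich[where f = "\<lambda>_. 0"])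
    show "\<forall>\<^sub>F n in sequentially. (\<integral>x. \<bar>f x * e n x\<bar> \<partial>N)\<^sup>2
            \<le> (\<integral>x. (f x)\<^sup>2 \<partial>N) * (\<integral>x. (e n x)\<^sup>2 \<partial>N)"
      using e(1) by eventually_elim (rule Cauchy_Schwarz_integral[OF _ _ f], auto)
    show "(\<lambda>n. (\<integral>x. (f x)\<^sup>2 \<partial>N) * (\<integral>x. (e n x)\<^sup>2 \<partial>N)) \<longlonglongrightarrow> 0"
      using tendsto_mult[OF tendsto_const e(2)] by simp
  qed auto
  from tendsto_real_sqrt[OF this] show ?thesis by (simp add: integral_nonneg_AE)
qed

text \<open>
  With \<open>e = f - g n\<close> one has \<open>(g n)\<^sup>2 = f\<^sup>2 + e\<^sup>2 - 2 * f * e\<close>, and the last two terms have vanishing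
  integrals. Square integrability of \<open>f\<close> comes from a single \<open>g m\<close> at finite distance.
\<close>

lemma L2_norm_tendsto:
  fixes f :: "'b \<Rightarrow> real" and g :: "nat \<Rightarrow> 'b \<Rightarrow> real"
  assumes [measurable]: "f \<in> borel_measurable N" "\<And>n. g n \<in> borel_measurable N"
    and g: "\<And>n. integrable N (\<lambda>x. (g n x)\<^sup>2)"
    and lim: "(\<lambda>n. \<integral>\<^sup>+x. ennreal ((f x - g n x)\<^sup>2) \<partial>N) \<longlonglongrightarrow> 0"
  shows "(\<lambda>n. \<integral>x. (g n x)\<^sup>2 \<partial>N) \<longlonglongrightarrow> (\<integral>x. (f x)\<^sup>2 \<partial>N)"
proof -
  have em: "(\<lambda>x. f x - g n x) \<in> borel_measurable N" for n by measurable
  note e = L2_null_sequence[OF em lim]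
  obtain m where m: "integrable N (\<lambda>x. (f x - g m x)\<^sup>2)"
    using eventually_happens[OF e(1)] by auto
  have bound: "(f x)\<^sup>2 \<le> 2 * (f x - g m x)\<^sup>2 + 2 * (g m x)\<^sup>2" for x
    using zero_le_power2[of "f x - 2 * g m x"] by (simp add: power2_eq_square algebra_simps)
  have f: "integrable N (\<lambda>x. (f x)\<^sup>2)"
  proof (rule Bochner_Integration.integrable_bound)
    show "integrable N (\<lambda>x. 2 * (f x - g m x)\<^sup>2 + 2 * (g m x)\<^sup>2)" using m g by auto
  qed (use bound in auto)
  have "(\<lambda>n. \<integral>x. \<bar>f x * (f x - g n x)\<bar> \<partial>N) \<longlonglongrightarrow> 0"
    by (rule L2_pairing_tendsto_0[OF _ em f lim]) auto
  then have "(\<lambda>n. \<integral>x. f x * (f x - g n x) \<partial>N) \<longlonglongrightarrow> 0"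
    by (rule Lim_null_comparison[rotated]) (auto intro!: always_eventually integral_abs_bound)
  then have lim': "(\<lambda>n. (\<integral>x. (f x)\<^sup>2 \<partial>N) + (\<integral>x. (f x - g n x)\<^sup>2 \<partial>N)
        - 2 * (\<integral>x. f x * (f x - g n x) \<partial>N)) \<longlonglongrightarrow> (\<integral>x. (f x)\<^sup>2 \<partial>N) + 0 - 2 * 0"
    by (intro tendsto_intros e(2))
  have "\<forall>\<^sub>F n in sequentially. (\<integral>x. (f x)\<^sup>2 \<partial>N) + (\<integral>x. (f x - g n x)\<^sup>2 \<partial>N)
        - 2 * (\<integral>x. f x * (f x - g n x) \<partial>N) = (\<integral>x. (g n x)\<^sup>2 \<partial>N)"
    using e(1)
  proof eventually_elim
    case (elim n)
    have i: "integrable N (\<lambda>x. f x * (f x - g n x))"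
      by (rule Cauchy_Schwarz_integral[OF _ _ f elim]) auto
    have "(\<integral>x. (g n x)\<^sup>2 \<partial>N)
        = (\<integral>x. (f x)\<^sup>2 + (f x - g n x)\<^sup>2 - 2 * (f x * (f x - g n x)) \<partial>N)"
      by (intro Bochner_Integration.integral_cong) (auto simp: power2_eq_square algebra_simps)
    also have "\<dots> = (\<integral>x. (f x)\<^sup>2 \<partial>N) + (\<integral>x. (f x - g n x)\<^sup>2 \<partial>N)
        - 2 * (\<integral>x. f x * (f x - g n x) \<partial>N)"
      using f elim i by simp
    finally show ?case by simp
  qed
  from Lim_transform_eventually[OF lim' this]
  show "(\<lambda>n. \<integral>x. (g n x)\<^sup>2 \<partial>N) \<longlonglongrightarrow> (\<integral>x. (f x)\<^sup>2 \<partial>N)" by simp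
qed

text \<open>
  Because \<open>iexp\<close> is 1-Lipschitz, characteristic functions at \<open>u\<close> differ by at most \<open>\<bar>u\<bar>\<close> times the
  \<open>L\<^sup>1\<close> distance, which the \<open>L\<^sup>2\<close> distance controls on a probability space.
\<close>

lemma (in prob_space) char_distr_L2_limit:
  fixes I :: "'a \<Rightarrow> real" and J :: "nat \<Rightarrow> 'a \<Rightarrow> real"
  assumes [measurable]: "I \<in> borel_measurable M" "\<And>n. J n \<in> borel_measurable M"
    and lim: "(\<lambda>n. \<integral>\<^sup>+\<omega>. ennreal ((I \<omega> - J n \<omega>)\<^sup>2) \<partial>M) \<longlonglongrightarrow> 0"
  shows "(\<lambda>n. char (distr M borel (J n)) u) \<longlonglongrightarrow> char (distr M borel I) u"
proof (rule LIM_zero_cancel, rule Lim_null_comparison)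
  have em: "(\<lambda>\<omega>. I \<omega> - J n \<omega>) \<in> borel_measurable M" for n by measurable
  show "(\<lambda>n. \<integral>\<omega>. \<bar>u * (I \<omega> - J n \<omega>)\<bar> \<partial>M) \<longlonglongrightarrow> 0"
    by (rule L2_pairing_tendsto_0[OF _ em _ lim]) auto
  show "\<forall>\<^sub>F n in sequentially. norm (char (distr M borel (J n)) u - char (distr M borel I) u)
          \<le> (\<integral>\<omega>. \<bar>u * (I \<omega> - J n \<omega>)\<bar> \<partial>M)"
    using L2_null_sequence(1)[OF em lim]
  proof eventually_elim
    case (elim n)
    have int: "integrable M (\<lambda>\<omega>. I \<omega> - J n \<omega>)"
      by (rule square_integrable_imp_integrable[OF em elim])
    have ii: "integrable M (\<lambda>\<omega>. iexp (u * Y \<omega>))" if "Y \<in> borel_measurable M" for Y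
      using that by (intro integrable_iexp) auto
    have Lip: "cmod (iexp a - iexp b) \<le> \<bar>a - b\<bar>" for a b :: real
    proof -
      have "iexp a - iexp b = iexp b * (iexp (a - b) - 1)"
        by (simp add: algebra_simps flip: exp_add)
      moreover have "cmod (iexp (a - b) - 1) \<le> \<bar>a - b\<bar>"
        using iexp_approx1[of "a - b" 0] by simp
      ultimately show ?thesis by (simp add: norm_mult)
    qed
    have "norm (char (distr M borel (J n)) u - char (distr M borel I) u)
        = norm (\<integral>\<omega>. iexp (u * J n \<omega>) - iexp (u * I \<omega>) \<partial>M)"
      by (simp add: char_def integral_distr ii Bochner_Integration.integral_diff del: of_real_mult)
    also have "\<dots> \<le> (\<integral>\<omega>. cmod (iexp (u * J n \<omega>) - iexp (u * I \<omega>)) \<partial>M)"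
      by (rule integral_norm_bound)
    also have "\<dots> \<le> (\<integral>\<omega>. \<bar>u * (I \<omega> - J n \<omega>)\<bar> \<partial>M)"
    proof (rule integral_mono)
      show "integrable M (\<lambda>\<omega>. cmod (iexp (u * J n \<omega>) - iexp (u * I \<omega>)))"
        by (intro integrable_norm Bochner_Integration.integrable_diff ii) auto
      show "integrable M (\<lambda>\<omega>. \<bar>u * (I \<omega> - J n \<omega>)\<bar>)" using int by auto
      show "cmod (iexp (u * J n \<omega>) - iexp (u * I \<omega>)) \<le> \<bar>u * (I \<omega> - J n \<omega>)\<bar>" for \<omega>
        using Lip[of "u * J n \<omega>" "u * I \<omega>"]
        by (simp add: algebra_simps abs_minus_commute)
    qed
    finally show ?case .
  qed
qed

section \<open>Step functions on a common grid\<close>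

lemma grid_telescope:
  fixes F :: "real \<Rightarrow> real"
  assumes mono: "\<And>i j. i < j \<Longrightarrow> j \<le> n \<Longrightarrow> t i < t j"
    and jk: "j \<le> k" "k \<le> n"
  shows "F (t k) - F (t j)
    = (\<Sum>i<n. (if t j \<le> t i \<and> t i < t k then 1 else 0) * (F (t (Suc i)) - F (t i)))"
proof -
  have le: "t i \<le> t i' \<longleftrightarrow> i \<le> i'" "t i < t i' \<longleftrightarrow> i < i'" if "i \<le> n" "i' \<le> n" for i i'
    using mono[of i i'] mono[of i' i] that by (cases i i' rule: linorder_cases; force)+
  have "F (t k) - F (t j) = (\<Sum>i=j..<k. F (t (Suc i)) - F (t i))"
    using sum_Suc_diff'[OF jk(1), of "\<lambda>i. F (t i)"] by simp
  also have "\<dots> = (\<Sum>i<n. if j \<le> i \<and> i < k then F (t (Suc i)) - F (t i) else 0)"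
    using jk by (intro sum.mono_neutral_cong_left) auto
  also have "\<dots> = (\<Sum>i<n. (if t j \<le> t i \<and> t i < t k then 1 else 0) * (F (t (Suc i)) - F (t i)))"
    using jk by (intro sum.cong) (auto simp: le)
  finally show ?thesis .
qed

text \<open>
  The intervals of a step list may overlap. Cutting all of them at all end points turns them into
  disjoint grid cells. Quantifying over \<open>F\<close> makes one refinement serve both the step function
  (\<open>F u\<close> is the indicator of \<open>s \<le> u\<close>) and its integral (\<open>F\<close> is a Brownian path).
\<close>

lemma step_list_common_grid:
  fixes xs :: "(real \<times> real \<times> real) list"
  assumes "step_list xs"
  shows "\<exists>(n :: nat) (t :: nat \<Rightarrow> real) (d :: nat \<Rightarrow> real).
    0 \<le> t 0 \<and> (\<forall>i j. i < j \<longrightarrow> j \<le> n \<longrightarrow> t i < t j) \<and>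
    (\<forall>F :: real \<Rightarrow> real. (\<Sum>(c, a, b)\<leftarrow>xs. c * (F b - F a))
        = (\<Sum>i<n. d i * (F (t (Suc i)) - F (t i))))"
proof -
  \<comment> \<open>Adding 0 keeps the grid nonempty for the empty list.\<close>
  define P where "P = insert 0 (\<Union>(c, a, b)\<in>set xs. {a, b})"
  define l where "l = sorted_list_of_set P"
  define n where "n = length l - 1"
  define t where "t = (\<lambda>i. l ! i)"
  define d where "d = (\<lambda>i. \<Sum>(c, a, b)\<leftarrow>xs. c * (if a \<le> t i \<and> t i < b then 1 else 0))"
  have P: "finite P" unfolding P_def by auto
  have set_l: "set l = P" unfolding l_def using P by simp
  have "0 \<in> set l" unfolding set_l P_def by simp
  then have len: "length l = Suc n" unfolding n_def by (cases l) auto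
  have t_mem: "t i \<in> P" if "i \<le> n" for i
    using that len unfolding t_def set_l[symmetric] by simp
  have t_surj: "\<exists>i\<le>n. t i = a" if "a \<in> P" for a
    using that len unfolding t_def set_l[symmetric] by (metis in_set_conv_nth less_Suc_eq_le)
  have P_nonneg: "0 \<le> a" if "a \<in> P" for a
    using that assms unfolding P_def step_list_def by fastforce
  have mono: "t i < t j" if "i < j" "j \<le> n" for i j
    using that len sorted_list_of_set.strict_sorted_key_list_of_set[of P]
    unfolding t_def l_def by (intro sorted_wrt_nth_less[of "(<)"]) auto
  have sub: "(\<Sum>(c, a, b)\<leftarrow>ys. c * (F b - F a))
        = (\<Sum>i<n. (\<Sum>(c, a, b)\<leftarrow>ys. c * (if a \<le> t i \<and> t i < b then 1 else 0)) * (F (t (Suc i)) - F (t i)))"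
    if "set ys \<subseteq> set xs" for ys :: "(real \<times> real \<times> real) list" and F :: "real \<Rightarrow> real"
    using that
  proof (induction ys)
    case (Cons y ys)
    obtain c a b where y: "y = (c, a, b)" by (cases y)
    have mem: "(c, a, b) \<in> set xs" using Cons.prems y by simp
    then have "a \<in> P" "b \<in> P" unfolding P_def by force+
    then obtain j k where jk: "j \<le> n" "t j = a" "k \<le> n" "t k = b" using t_surj by metis
    have "a \<le> b" using mem assms unfolding step_list_def by auto
    with jk have "j \<le> k" using mono[of k j] by (metis not_le)
    have "F b - F a = (\<Sum>i<n. (if a \<le> t i \<and> t i < b then 1 else 0) * (F (t (Suc i)) - F (t i)))"
      using grid_telescope[where t = t and n = n and F = F, OF mono \<open>j \<le> k\<close> jk(3)] jk(2,4) by simp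
    then show ?case
      using Cons unfolding y by (simp add: sum_distrib_left distrib_right sum.distrib mult.assoc)
  qed simp
  have "0 \<le> t 0" using P_nonneg[OF t_mem[of 0]] by simp
  show ?thesis
  proof (intro exI conjI allI impI)
    show "(\<Sum>(c, a, b)\<leftarrow>xs. c * (F b - F a)) = (\<Sum>i<n. d i * (F (t (Suc i)) - F (t i)))"
      for F :: "real \<Rightarrow> real" unfolding d_def by (rule sub) simp
  qed (fact \<open>0 \<le> t 0\<close>, rule mono)
qed

lemma step_fun_eq_indicator_diff:
  assumes "step_list xs"
  shows "step_fun xs s = (\<Sum>(c, a, b)\<leftarrow>xs. c * ((if s \<le> b then 1 else 0) - (if s \<le> a then 1 else 0)))"
proof -
  have eq: "map (\<lambda>(c, a, b). c * indicator {a<..b} s) xs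
     = map (\<lambda>(c, a, b). c * ((if s \<le> b then 1 else 0) - (if s \<le> a then 1 else 0) :: real)) xs"
    using assms unfolding step_list_def by (intro map_cong) (auto split: split_indicator)
  show ?thesis unfolding step_fun_def eq ..
qed

text \<open>
  The cells of the grid are disjoint, so in the square of the sum only the diagonal survives.
\<close>

lemma step_fun_grid_L2:
  assumes mono: "\<And>i j. i < j \<Longrightarrow> j \<le> n \<Longrightarrow> t i < t j"
  shows "integrable lborel (\<lambda>s. (\<Sum>i<n. d i * indicator {t i<..t (Suc i)} s :: real)\<^sup>2)"
    and "(\<integral>s. (\<Sum>i<n. d i * indicator {t i<..t (Suc i)} s)\<^sup>2 \<partial>lborel)
      = (\<Sum>i<n. (d i)\<^sup>2 * (t (Suc i) - t i))"
proof -
  have disj: "indicator {t i<..t (Suc i)} s * indicator {t j<..t (Suc j)} s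
      = (if i = j then indicator {t i<..t (Suc i)} s else (0 :: real))"
    if "i < n" "j < n" for i j s
  proof (cases i j rule: linorder_cases)
    case less
    then have "t (Suc i) \<le> t j"
      using mono[of "Suc i" j] that by (cases "Suc i = j") (auto intro!: less_imp_le)
    with less show ?thesis by (auto split: split_indicator)
  next
    case greater
    then have "t (Suc j) \<le> t i"
      using mono[of "Suc j" i] that by (cases "Suc j = i") (auto intro!: less_imp_le)
    with greater show ?thesis by (auto split: split_indicator)
  qed (auto split: split_indicator)
  have sq: "(\<Sum>i<n. d i * indicator {t i<..t (Suc i)} s)\<^sup>2
      = (\<Sum>i<n. (d i)\<^sup>2 * indicator {t i<..t (Suc i)} s)" for s
  proof -
    have "(\<Sum>i<n. d i * indicator {t i<..t (Suc i)} s)\<^sup>2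
        = (\<Sum>i<n. \<Sum>j<n. d i * d j * (indicator {t i<..t (Suc i)} s * indicator {t j<..t (Suc j)} s))"
      unfolding power2_eq_square sum_product by (intro sum.cong refl) (simp only: mult_ac)
    also have "\<dots> = (\<Sum>i<n. \<Sum>j<n. if i = j then d i * d j * indicator {t i<..t (Suc i)} s else 0)"
      by (intro sum.cong refl) (subst disj, auto)
    also have "\<dots> = (\<Sum>i<n. (d i)\<^sup>2 * indicator {t i<..t (Suc i)} s)"
      by (simp add: power2_eq_square)
    finally show ?thesis .
  qed
  have le: "t i \<le> t (Suc i)" if "i < n" for i using mono[of i "Suc i"] that by simp
  have int: "integrable lborel (\<lambda>s. (d i)\<^sup>2 * indicator {t i<..t (Suc i)} s)" if "i < n" for i
    using le[OF that] by (intro integrable_mult_right) (simp add: integrable_indicator_iff)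
  show "integrable lborel (\<lambda>s. (\<Sum>i<n. d i * indicator {t i<..t (Suc i)} s :: real)\<^sup>2)"
    unfolding sq by (intro Bochner_Integration.integrable_sum int) auto
  have "(\<integral>s. (\<Sum>i<n. (d i)\<^sup>2 * indicator {t i<..t (Suc i)} s) \<partial>lborel)
      = (\<Sum>i<n. \<integral>s. (d i)\<^sup>2 * indicator {t i<..t (Suc i)} s \<partial>lborel)"
    by (intro Bochner_Integration.integral_sum int) auto
  also have "\<dots> = (\<Sum>i<n. (d i)\<^sup>2 * (t (Suc i) - t i))"
    using le by (intro sum.cong) (auto simp: measure_def)
  finally show "(\<integral>s. (\<Sum>i<n. d i * indicator {t i<..t (Suc i)} s)\<^sup>2 \<partial>lborel)
      = (\<Sum>i<n. (d i)\<^sup>2 * (t (Suc i) - t i))" unfolding sq .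
qed

section \<open>Wiener integrals are Gaussian\<close>

lemma step_fun_measurable [measurable]: "step_fun xs \<in> borel_measurable borel"
  unfolding step_fun_def[abs_def] by (induction xs) auto

lemma char_distr_scale:
  assumes [measurable]: "Y \<in> borel_measurable M"
  shows "char (distr M borel (\<lambda>\<omega>. c * Y \<omega>)) u = char (distr M borel Y) (u * c)"
  by (simp add: char_def integral_distr mult.assoc)

context standard_brownian_motion
begin

lemma char_increment:
  assumes "0 \<le> s" "s < t"
  shows "char (distr M borel (\<lambda>\<omega>. B t \<omega> - B s \<omega>)) u = of_real (exp (- (u\<^sup>2 * (t - s)) / 2))"
proof -
  define \<sigma> where "\<sigma> = sqrt (t - s)"
  have \<sigma>: "0 < \<sigma>" "\<sigma>\<^sup>2 = t - s" using assms unfolding \<sigma>_def by auto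
  have [measurable]: "B t \<in> borel_measurable M" "B s \<in> borel_measurable M"
    using assms by (auto intro: B_measurable)
  have "distributed M lborel (\<lambda>\<omega>. (B t \<omega> - B s \<omega> - 0) / \<sigma>) std_normal_density"
    using B_normal_increments[OF assms] \<sigma>(1) unfolding \<sigma>_def[symmetric]
    by (subst (asm) normal_standard_normal_convert) auto
  then have "distr M lborel (\<lambda>\<omega>. (B t \<omega> - B s \<omega>) / \<sigma>) = std_normal_distribution"
    by (simp add: distributed_distr_eq_density)
  moreover have "distr M lborel (\<lambda>\<omega>. (B t \<omega> - B s \<omega>) / \<sigma>) = distr M borel (\<lambda>\<omega>. (B t \<omega> - B s \<omega>) / \<sigma>)"
    by (rule distr_cong) auto
  ultimately have std: "distr M borel (\<lambda>\<omega>. (B t \<omega> - B s \<omega>) / \<sigma>) = std_normal_distribution" by simp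
  have "char (distr M borel (\<lambda>\<omega>. B t \<omega> - B s \<omega>)) u
      = char (distr M borel (\<lambda>\<omega>. \<sigma> * ((B t \<omega> - B s \<omega>) / \<sigma>))) u"
    using \<sigma>(1) by simp
  also have "\<dots> = char std_normal_distribution (u * \<sigma>)"
    by (subst char_distr_scale) (auto simp: std)
  also have "\<dots> = of_real (exp (- (u\<^sup>2 * (t - s)) / 2))"
    by (simp add: char_std_normal_distribution power_mult_distrib \<sigma>)
  finally show ?thesis .
qed

lemma step_integral_measurable:
  assumes "step_list xs"
  shows "step_integral B xs \<in> borel_measurable M"
  using assms
proof (induction xs)
  case Nil
  then show ?case by (simp add: step_integral_def[abs_def])
next
  case (Cons x xs)
  obtain c a b where x: "x = (c, a, b)" by (cases x)
  have [measurable]: "B a \<in> borel_measurable M" "B b \<in> borel_measurable M"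
    "step_integral B xs \<in> borel_measurable M"
    using Cons unfolding step_list_def x by (auto intro!: B_measurable)
  have "step_integral B (x # xs) = (\<lambda>\<omega>. c * (B b \<omega> - B a \<omega>) + step_integral B xs \<omega>)"
    by (auto simp: step_integral_def x fun_eq_iff)
  then show ?case by simp
qed

text \<open>
  The Ito isometry together with normality: on a common grid the integral is a sum of
  independent normal variables, whose variances add up to the squared norm of the step function.
\<close>

lemma char_step_integral:
  assumes "step_list xs"
  shows "integrable lborel (\<lambda>s. (step_fun xs s)\<^sup>2)"
    and "char (distr M borel (step_integral B xs)) u
      = of_real (exp (- (u\<^sup>2 * (\<integral>s. (step_fun xs s)\<^sup>2 \<partial>lborel)) / 2))"
proof -
  obtain n t d where "0 \<le> t 0 \<and> (\<forall>i j. i < j \<longrightarrow> j \<le> n \<longrightarrow> t i < t j) \<and>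
    (\<forall>F :: real \<Rightarrow> real. (\<Sum>(c, a, b)\<leftarrow>xs. c * (F b - F a))
        = (\<Sum>i<n. d i * (F (t (Suc i)) - F (t i))))"
    using step_list_common_grid[OF assms] by (elim exE) (erule that)
  then have t0: "0 \<le> t 0" and mono: "\<And>i j. i < j \<Longrightarrow> j \<le> n \<Longrightarrow> t i < t j"
    and grid: "\<And>F :: real \<Rightarrow> real. (\<Sum>(c, a, b)\<leftarrow>xs. c * (F b - F a))
        = (\<Sum>i<n. d i * (F (t (Suc i)) - F (t i)))"
    by simp_all
  have fun_eq: "step_fun xs s = (\<Sum>i<n. d i * indicator {t i<..t (Suc i)} s)" for s
  proof -
    have "step_fun xs s = (\<Sum>i<n. d i * ((if s \<le> t (Suc i) then 1 else 0) - (if s \<le> t i then 1 else 0)))"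
      unfolding step_fun_eq_indicator_diff[OF assms] by (rule grid)
    also have "\<dots> = (\<Sum>i<n. d i * indicator {t i<..t (Suc i)} s)"
    proof (intro sum.cong refl)
      fix i assume "i \<in> {..<n}"
      then have "t i < t (Suc i)" by (intro mono) auto
      then show "d i * ((if s \<le> t (Suc i) then 1 else 0) - (if s \<le> t i then 1 else 0))
          = d i * indicator {t i<..t (Suc i)} s"
        by (auto split: split_indicator)
    qed
    finally show ?thesis .
  qed
  have int_eq: "step_integral B xs = (\<lambda>\<omega>. \<Sum>i<n. d i * (B (t (Suc i)) \<omega> - B (t i) \<omega>))"
    unfolding step_integral_def by (rule ext, rule grid)
  show "integrable lborel (\<lambda>s. (step_fun xs s)\<^sup>2)"
    unfolding fun_eq by (rule step_fun_grid_L2(1)[OF mono])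
  have nonneg: "0 \<le> t i" if "i \<le> n" for i
    using t0 mono[of 0 i] that by (cases "i = 0") auto
  have [measurable]: "B (t i) \<in> borel_measurable M" if "i \<le> n" for i
    using nonneg[OF that] by (rule B_measurable)
  have "indep_vars (\<lambda>_. borel) (\<lambda>i \<omega>. B (t (Suc i)) \<omega> - B (t i) \<omega>) {..<n}"
    using t0 mono by (intro B_indep_increments) (auto intro: less_imp_le)
  then have indep: "indep_vars (\<lambda>_. borel) (\<lambda>i \<omega>. d i * (B (t (Suc i)) \<omega> - B (t i) \<omega>)) {..<n}"
    by (rule indep_vars_compose2) auto
  have "char (distr M borel (step_integral B xs)) u
      = (\<Prod>i<n. char (distr M borel (\<lambda>\<omega>. d i * (B (t (Suc i)) \<omega> - B (t i) \<omega>))) u)"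
    unfolding int_eq by (rule char_distr_sum[OF indep])
  also have "\<dots> = (\<Prod>i<n. of_real (exp (- (u\<^sup>2 * ((d i)\<^sup>2 * (t (Suc i) - t i))) / 2)))"
  proof (intro prod.cong refl)
    fix i assume i: "i \<in> {..<n}"
    have "char (distr M borel (\<lambda>\<omega>. d i * (B (t (Suc i)) \<omega> - B (t i) \<omega>))) u
        = char (distr M borel (\<lambda>\<omega>. B (t (Suc i)) \<omega> - B (t i) \<omega>)) (u * d i)"
      using i by (intro char_distr_scale) auto
    also have "\<dots> = of_real (exp (- ((u * d i)\<^sup>2 * (t (Suc i) - t i)) / 2))"
      using i by (intro char_increment nonneg mono) auto
    finally show "char (distr M borel (\<lambda>\<omega>. d i * (B (t (Suc i)) \<omega> - B (t i) \<omega>))) u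
        = of_real (exp (- (u\<^sup>2 * ((d i)\<^sup>2 * (t (Suc i) - t i))) / 2))"
      by (simp add: power_mult_distrib mult.assoc)
  qed
  also have "\<dots> = of_real (exp (- (u\<^sup>2 * (\<Sum>i<n. (d i)\<^sup>2 * (t (Suc i) - t i))) / 2))"
    unfolding of_real_prod[symmetric]
    by (subst exp_sum[symmetric]) (simp_all only: sum_distrib_left sum_negf[symmetric] sum_divide_distrib finite_lessThan)
  also have "(\<Sum>i<n. (d i)\<^sup>2 * (t (Suc i) - t i)) = (\<integral>s. (step_fun xs s)\<^sup>2 \<partial>lborel)"
    unfolding fun_eq by (rule step_fun_grid_L2(2)[OF mono, symmetric])
  finally show "char (distr M borel (step_integral B xs)) u
      = of_real (exp (- (u\<^sup>2 * (\<integral>s. (step_fun xs s)\<^sup>2 \<partial>lborel)) / 2))" .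
qed

text \<open>
  Both sides have the characteristic function \<open>exp (- u\<^sup>2 * v / 2)\<close>, where \<open>v\<close> is the squared norm
  of \<open>f\<close>; Levy's uniqueness theorem then identifies the laws. Writing the normal law as an image
  of the standard one covers the degenerate case \<open>v = 0\<close>.
\<close>

lemma wiener_integral_gaussian:
  assumes W: "has_wiener_integral M B f I" and zero: "\<And>s. s \<le> 0 \<Longrightarrow> f s = 0"
  shows "distr M borel I
      = distr std_normal_distribution borel (\<lambda>x. sqrt (\<integral>s. (f s)\<^sup>2 \<partial>lborel) * x)"
proof -
  from W obtain xs where [measurable]: "f \<in> borel_measurable borel" "I \<in> borel_measurable M"
    and xs: "\<And>n. step_list (xs n)"
    and lim_f: "(\<lambda>n. \<integral>\<^sup>+s\<in>{0..}. ennreal ((f s - step_fun (xs n) s)\<^sup>2) \<partial>lborel) \<longlonglongrightarrow> 0"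
    and lim_I: "(\<lambda>n. \<integral>\<^sup>+\<omega>. ennreal ((I \<omega> - step_integral B (xs n) \<omega>)\<^sup>2) \<partial>M) \<longlonglongrightarrow> 0"
    unfolding has_wiener_integral_def by blast
  \<comment> \<open>Like \<open>f\<close>, step functions vanish outside the positive half-line, so the integrals extend to the whole line.\<close>
  have step_zero: "step_fun (xs n) s = 0" if "s \<le> 0" for n s
  proof -
    have "indicator {a<..b} s = (0 :: real)" if "(c, a, b) \<in> set (xs n)" for a b c
      using xs[of n] that \<open>s \<le> 0\<close> unfolding step_list_def by (auto split: split_indicator)
    then have eq: "map (\<lambda>(c, a, b). c * indicator {a<..b} s) (xs n) = map (\<lambda>_. 0) (xs n)"
      by (intro map_cong) auto
    show ?thesis unfolding step_fun_def eq by simp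
  qed
  have "(\<integral>\<^sup>+s\<in>{0..}. ennreal ((f s - step_fun (xs n) s)\<^sup>2) \<partial>lborel)
      = (\<integral>\<^sup>+s. ennreal ((f s - step_fun (xs n) s)\<^sup>2) \<partial>lborel)" for n
    by (intro nn_integral_cong) (auto simp: zero step_zero split: split_indicator)
  with lim_f have lim_f': "(\<lambda>n. \<integral>\<^sup>+s. ennreal ((f s - step_fun (xs n) s)\<^sup>2) \<partial>lborel) \<longlonglongrightarrow> 0"
    by simp
  define v where "v = (\<integral>s. (f s)\<^sup>2 \<partial>lborel)"
  have "(\<lambda>n. \<integral>s. (step_fun (xs n) s)\<^sup>2 \<partial>lborel) \<longlonglongrightarrow> v"
    unfolding v_def by (rule L2_norm_tendsto[OF _ _ char_step_integral(1)[OF xs] lim_f']) auto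
  then have lim1: "(\<lambda>n. char (distr M borel (step_integral B (xs n))) u)
      \<longlonglongrightarrow> of_real (exp (- (u\<^sup>2 * v) / 2))" for u
    unfolding char_step_integral(2)[OF xs] by (intro tendsto_intros) auto
  have lim2: "(\<lambda>n. char (distr M borel (step_integral B (xs n))) u) \<longlonglongrightarrow> char (distr M borel I) u" for u
    by (rule char_distr_L2_limit[OF _ _ lim_I]) (auto intro: step_integral_measurable xs)
  have char_I: "char (distr M borel I) u = of_real (exp (- (u\<^sup>2 * v) / 2))" for u
    by (rule LIMSEQ_unique[OF lim2 lim1])
  interpret N: real_distribution std_normal_distribution by (rule real_dist_normal_dist)
  have v: "0 \<le> v" unfolding v_def by simp
  have std: "distr std_normal_distribution borel (\<lambda>x. x) = std_normal_distribution"
    by (rule distr_id2) simp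
  have char_N: "char (distr std_normal_distribution borel (\<lambda>x. sqrt v * x)) u
      = of_real (exp (- (u\<^sup>2 * v) / 2))" for u
    using v by (subst char_distr_scale)
      (simp_all add: std char_std_normal_distribution power_mult_distrib)
  show "distr M borel I = distr std_normal_distribution borel (\<lambda>x. sqrt (\<integral>s. (f s)\<^sup>2 \<partial>lborel) * x)"
    unfolding v_def[symmetric]
  proof (rule Levy_uniqueness)
    show "real_distribution (distr M borel I)" by (rule real_distribution_distr) simp
    show "real_distribution (distr std_normal_distribution borel (\<lambda>x. sqrt v * x))"
      by (rule N.real_distribution_distr) simp
  qed (auto simp: char_I char_N)
qed

end

section \<open>Absolute moments of Wiener integrals\<close>

definition normal_abs_moment :: "real \<Rightarrow> real" where
  "normal_abs_moment p = (\<integral>x. \<bar>x\<bar> powr p \<partial>std_normal_distribution)"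

lemma integrable_normal_abs_powr:
  assumes "0 < p"
  shows "integrable std_normal_distribution (\<lambda>x. \<bar>x\<bar> powr p)"
proof -
  interpret N: real_distribution std_normal_distribution by (rule real_dist_normal_dist)
  \<comment> \<open>An even integer exponent not below \<open>p\<close> dominates wherever \<open>\<bar>x\<bar>\<close> exceeds 1.\<close>
  define m where "m = nat \<lceil>p\<rceil>"
  have pm: "p \<le> real (2 * m)" using assms unfolding m_def by linarith
  show ?thesis
  proof (rule Bochner_Integration.integrable_bound)
    show "integrable std_normal_distribution (\<lambda>x. 1 + x ^ (2 * m))"
      using integrable_std_normal_distribution_moment[of "2 * m"] N.integrable_const[of "1::real"]
      by (intro Bochner_Integration.integrable_add)
    have "\<bar>x\<bar> powr p \<le> 1 + x ^ (2 * m)" for x :: real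
    proof (cases "\<bar>x\<bar> \<le> 1")
      case True
      then have "\<bar>x\<bar> powr p \<le> 1" using assms by (intro powr_le1) auto
      then show ?thesis by (smt (verit) zero_le_even_power' power_mult zero_le_power2 zero_le_power)
    next
      case False
      then have "\<bar>x\<bar> powr p \<le> \<bar>x\<bar> powr real (2 * m)" using pm by (intro powr_mono) auto
      also have "\<dots> = x ^ (2 * m)" using False by (subst powr_realpow) (auto simp: power_even_abs)
      finally show ?thesis by simp
    qed
    then show "AE x in std_normal_distribution. norm (\<bar>x\<bar> powr p) \<le> norm (1 + x ^ (2 * m))"
      by (auto intro!: AE_I2 simp: abs_le_iff intro: order_trans[OF _ abs_ge_self])
  qed auto
qed

text \<open>
  A vanishing moment would force the normal law to sit at the origin, a Lebesgue null set.
\<close>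

lemma normal_abs_moment_pos:
  assumes "0 < p"
  shows "0 < normal_abs_moment p"
proof -
  have "normal_abs_moment p \<noteq> 0"
  proof
    assume "normal_abs_moment p = 0"
    then have "AE x in std_normal_distribution. \<bar>x\<bar> powr p = 0"
      unfolding normal_abs_moment_def
      by (subst (asm) integral_nonneg_eq_0_iff_AE) (auto intro: integrable_normal_abs_powr assms)
    then have "AE x in lborel. \<bar>x\<bar> powr p = 0"
      by (subst (asm) AE_density) (auto simp: normal_density_pos)
    moreover have "AE x in lborel. x \<noteq> (0::real)" by (rule AE_lborel_singleton)
    ultimately have "AE x in (lborel :: real measure). False" by eventually_elim auto
    then show False by (simp add: AE_iff_null null_sets_def)
  qed
  moreover have "0 \<le> normal_abs_moment p" unfolding normal_abs_moment_def by simp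
  ultimately show ?thesis by simp
qed

lemma (in standard_brownian_motion) wiener_integral_abs_moment:
  assumes W: "has_wiener_integral M B f I" and zero: "\<And>s. s \<le> 0 \<Longrightarrow> f s = 0" and p: "0 < p"
  shows "(\<integral>\<^sup>+\<omega>. ennreal (\<bar>I \<omega>\<bar> powr p) \<partial>M)
    = ennreal (normal_abs_moment p * (\<integral>s. (f s)\<^sup>2 \<partial>lborel) powr (p / 2))"
proof -
  define \<sigma> where "\<sigma> = sqrt (\<integral>s. (f s)\<^sup>2 \<partial>lborel)"
  have \<sigma>: "0 \<le> \<sigma>" unfolding \<sigma>_def by simp
  have [measurable]: "I \<in> borel_measurable M" using W unfolding has_wiener_integral_def by simp
  have "(\<integral>\<^sup>+\<omega>. ennreal (\<bar>I \<omega>\<bar> powr p) \<partial>M) = (\<integral>\<^sup>+x. ennreal (\<bar>x\<bar> powr p) \<partial>distr M borel I)"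
    by (simp add: nn_integral_distr)
  also have "distr M borel I = distr std_normal_distribution borel (\<lambda>x. \<sigma> * x)"
    unfolding \<sigma>_def by (rule wiener_integral_gaussian[OF W zero])
  also have "(\<integral>\<^sup>+x. ennreal (\<bar>x\<bar> powr p) \<partial>distr std_normal_distribution borel (\<lambda>x. \<sigma> * x))
      = (\<integral>\<^sup>+x. ennreal (\<bar>\<sigma> * x\<bar> powr p) \<partial>std_normal_distribution)"
    by (simp add: nn_integral_distr)
  also have "\<dots> = (\<integral>\<^sup>+x. ennreal (\<sigma> powr p) * ennreal (\<bar>x\<bar> powr p) \<partial>std_normal_distribution)"
    using \<sigma> by (simp add: abs_mult powr_mult ennreal_mult)
  also have "\<dots> = ennreal (\<sigma> powr p) * ennreal (normal_abs_moment p)"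
    using nn_integral_eq_integral[OF integrable_normal_abs_powr[OF p]]
    by (subst nn_integral_cmult) (auto simp: normal_abs_moment_def)
  also have "\<sigma> powr p = (\<integral>s. (f s)\<^sup>2 \<partial>lborel) powr (p / 2)"
    unfolding \<sigma>_def by (simp add: powr_half_sqrt[symmetric] powr_powr)
  finally show ?thesis using normal_abs_moment_pos[OF p] by (simp add: ennreal_mult mult.commute)
qed

text \<open>
  The weight \<open>w\<close> allows one statement to serve both the kernels, integrated over the half-line,
  and the random variables, integrated over the whole probability space.
\<close>

lemma weighted_L2_diff_tendsto_0:
  fixes f g :: "'b \<Rightarrow> real" and u v :: "nat \<Rightarrow> 'b \<Rightarrow> real" and w :: "'b \<Rightarrow> ennreal"
  assumes [measurable]: "f \<in> borel_measurable N" "g \<in> borel_measurable N" "w \<in> borel_measurable N"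
    "\<And>n. u n \<in> borel_measurable N" "\<And>n. v n \<in> borel_measurable N"
    and u: "(\<lambda>n. \<integral>\<^sup>+x. ennreal ((f x - u n x)\<^sup>2) * w x \<partial>N) \<longlonglongrightarrow> 0"
    and v: "(\<lambda>n. \<integral>\<^sup>+x. ennreal ((g x - v n x)\<^sup>2) * w x \<partial>N) \<longlonglongrightarrow> 0"
  shows "(\<lambda>n. \<integral>\<^sup>+x. ennreal ((f x - g x - (u n x - v n x))\<^sup>2) * w x \<partial>N) \<longlonglongrightarrow> 0"
proof (rule tendsto_sandwich[where f = "\<lambda>_. 0"])
  let ?b = "\<lambda>n. 2 * (\<integral>\<^sup>+x. ennreal ((f x - u n x)\<^sup>2) * w x \<partial>N)
      + 2 * (\<integral>\<^sup>+x. ennreal ((g x - v n x)\<^sup>2) * w x \<partial>N)"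
  have "?b \<longlonglongrightarrow> 2 * 0 + 2 * 0"
    by (intro tendsto_intros ennreal_tendsto_cmult u v) auto
  then show "?b \<longlonglongrightarrow> 0" by simp
  have sq: "(a - b)\<^sup>2 \<le> 2 * a\<^sup>2 + 2 * b\<^sup>2" for a b :: real
    using zero_le_power2[of "a + b"] by (simp add: power2_eq_square algebra_simps)
  have "ennreal ((f x - g x - (u n x - v n x))\<^sup>2)
      \<le> 2 * ennreal ((f x - u n x)\<^sup>2) + 2 * ennreal ((g x - v n x)\<^sup>2)" for n x
  proof -
    have "ennreal ((f x - g x - (u n x - v n x))\<^sup>2)
        \<le> ennreal (2 * (f x - u n x)\<^sup>2 + 2 * (g x - v n x)\<^sup>2)"
      using sq[of "f x - u n x" "g x - v n x"] by (intro ennreal_leI) (simp add: algebra_simps)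
    also have "\<dots> = 2 * ennreal ((f x - u n x)\<^sup>2) + 2 * ennreal ((g x - v n x)\<^sup>2)"
      by (simp add: ennreal_mult)
    finally show ?thesis .
  qed
  then have "(\<integral>\<^sup>+x. ennreal ((f x - g x - (u n x - v n x))\<^sup>2) * w x \<partial>N)
      \<le> (\<integral>\<^sup>+x. (2 * ennreal ((f x - u n x)\<^sup>2) + 2 * ennreal ((g x - v n x)\<^sup>2)) * w x \<partial>N)" for n
    by (intro nn_integral_mono mult_right_mono) auto
  also have "\<And>n. (\<integral>\<^sup>+x. (2 * ennreal ((f x - u n x)\<^sup>2) + 2 * ennreal ((g x - v n x)\<^sup>2)) * w x \<partial>N) = ?b n"
    by (simp add: distrib_right mult.assoc nn_integral_add nn_integral_cmult)
  finally show "\<forall>\<^sub>F n in sequentially.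
      (\<integral>\<^sup>+x. ennreal ((f x - g x - (u n x - v n x))\<^sup>2) * w x \<partial>N) \<le> ?b n"
    by (intro always_eventually allI)
qed auto

text \<open>
  Appending to one approximating list the negated other list approximates the difference.
\<close>

lemma (in standard_brownian_motion) has_wiener_integral_diff:
  assumes f: "has_wiener_integral M B f I" and g: "has_wiener_integral M B g J"
  shows "has_wiener_integral M B (\<lambda>s. f s - g s) (\<lambda>\<omega>. I \<omega> - J \<omega>)"
proof -
  from f obtain xs where [measurable]: "f \<in> borel_measurable borel" "I \<in> borel_measurable M"
    and xs: "\<And>n. step_list (xs n)"
    and xs_f: "(\<lambda>n. \<integral>\<^sup>+s\<in>{0..}. ennreal ((f s - step_fun (xs n) s)\<^sup>2) \<partial>lborel) \<longlonglongrightarrow> 0"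
    and xs_I: "(\<lambda>n. \<integral>\<^sup>+\<omega>. ennreal ((I \<omega> - step_integral B (xs n) \<omega>)\<^sup>2) \<partial>M) \<longlonglongrightarrow> 0"
    unfolding has_wiener_integral_def by blast
  from g obtain ys where [measurable]: "g \<in> borel_measurable borel" "J \<in> borel_measurable M"
    and ys: "\<And>n. step_list (ys n)"
    and ys_g: "(\<lambda>n. \<integral>\<^sup>+s\<in>{0..}. ennreal ((g s - step_fun (ys n) s)\<^sup>2) \<partial>lborel) \<longlonglongrightarrow> 0"
    and ys_J: "(\<lambda>n. \<integral>\<^sup>+\<omega>. ennreal ((J \<omega> - step_integral B (ys n) \<omega>)\<^sup>2) \<partial>M) \<longlonglongrightarrow> 0"
    unfolding has_wiener_integral_def by blast
  have [measurable]: "step_integral B (xs n) \<in> borel_measurable M"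
    "step_integral B (ys n) \<in> borel_measurable M" for n
    by (auto intro: step_integral_measurable xs ys)
  define zs where "zs = (\<lambda>n. xs n @ map (\<lambda>(c, a, b). (- c, a, b)) (ys n))"
  have zs: "step_list (zs n)" for n
    using xs[of n] ys[of n] unfolding step_list_def zs_def by fastforce
  have neg: "step_fun (map (\<lambda>(c, a, b). (- c, a, b)) ws) s = - step_fun ws s"
    "step_integral B (map (\<lambda>(c, a, b). (- c, a, b)) ws) \<omega> = - step_integral B ws \<omega>" for ws s \<omega>
    by (induction ws) (auto simp: step_fun_def step_integral_def)
  have zs_fun: "step_fun (zs n) s = step_fun (xs n) s - step_fun (ys n) s" for n s
    using neg(1)[of "ys n" s] unfolding zs_def by (simp add: step_fun_def)
  have zs_int: "step_integral B (zs n) \<omega> = step_integral B (xs n) \<omega> - step_integral B (ys n) \<omega>" for n \<omega>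
    using neg(2)[of "ys n" \<omega>] unfolding zs_def by (simp add: step_integral_def)
  have "(\<lambda>n. \<integral>\<^sup>+s\<in>{0..}. ennreal ((f s - g s - step_fun (zs n) s)\<^sup>2) \<partial>lborel) \<longlonglongrightarrow> 0"
    unfolding zs_fun by (rule weighted_L2_diff_tendsto_0[OF _ _ _ _ _ xs_f ys_g]) auto
  moreover have "(\<lambda>n. \<integral>\<^sup>+\<omega>. ennreal ((I \<omega> - J \<omega> - step_integral B (zs n) \<omega>)\<^sup>2) \<partial>M) \<longlonglongrightarrow> 0"
    unfolding zs_int
    using weighted_L2_diff_tendsto_0[of I M J "\<lambda>_. 1" "\<lambda>n. step_integral B (xs n)" "\<lambda>n. step_integral B (ys n)"]
      xs_I ys_J by simp
  ultimately show ?thesis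
    unfolding has_wiener_integral_def using zs by (intro conjI exI[of _ zs]) simp_all
qed

section \<open>Asymptotics of the increment variances\<close>

text \<open>
  After division by \<open>u powr b\<close> this is \<open>1 \<le> t powr b + (1 - t) powr b\<close> with \<open>t = v / u\<close>, which holds
  because \<open>t \<le> t powr b\<close> on the unit interval.
\<close>

lemma powr_diff_le_powr:
  fixes u v b :: real
  assumes "0 \<le> v" "v \<le> u" "0 < b" "b \<le> 1"
  shows "u powr b - v powr b \<le> (u - v) powr b"
proof (cases "u = 0")
  case False
  have ratio: "t \<le> t powr b" if "0 \<le> t" "t \<le> 1" for t :: real
    using powr_mono'[of b 1 t] that assms by simp
  have "1 = v / u + (u - v) / u" using False by (simp add: field_simps)
  also have "\<dots> \<le> (v / u) powr b + ((u - v) / u) powr b"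
    using assms False by (intro add_mono ratio) auto
  also have "\<dots> = (v powr b + (u - v) powr b) / u powr b"
    using assms by (simp add: powr_divide add_divide_distrib)
  finally show ?thesis using assms False by (simp add: field_simps)
qed (use assms in simp)

text \<open>
  This is \<open>(u / v) powr b \<le> u / v\<close>, multiplied by \<open>v powr b\<close>. For \<open>u\<close> and \<open>v\<close> close to each other
  and far from 0 it is much sharper than \<open>powr_diff_le_powr\<close>.
\<close>

lemma powr_diff_le_mult_diff:
  fixes u v b :: real
  assumes "0 < v" "v \<le> u" "b \<le> 1"
  shows "u powr b - v powr b \<le> v powr (b - 1) * (u - v)"
proof -
  have "u powr b = v powr b * (u / v) powr b"
    using assms by (simp add: powr_divide)
  also have "\<dots> \<le> v powr b * (u / v) powr 1"
    using assms by (intro mult_left_mono powr_mono) auto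
  also have "\<dots> = v powr b + v powr (b - 1) * (u - v)"
    using assms by (simp add: powr_diff field_simps)
  finally show ?thesis by simp
qed

text \<open>
  The difference of the kernels for the times \<open>k\<close> and \<open>k - 1\<close>, as a function of the distance \<open>x\<close> to
  the right end point \<open>k\<close>; here \<open>b = (\<alpha> - 1) / 2\<close>.
\<close>

definition hadamard_increment_kernel :: "real \<Rightarrow> real \<Rightarrow> real \<Rightarrow> real" where
  "hadamard_increment_kernel b k x =
     indicator {0<..<k} x * ln (k / (k - x)) powr b
     - indicator {1<..<k} x * ln ((k - 1) / (k - x)) powr b"

text \<open>
  The Mandelbrot-Van Ness kernel of a unit increment of fractional Brownian motion with Hurst
  index \<open>b + 1 / 2\<close>, up to normalization and again as a function of the distance to the right end point.
\<close>

definition fbm_increment_kernel :: "real \<Rightarrow> real \<Rightarrow> real" where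
  "fbm_increment_kernel b x = max 0 x powr b - max 0 (x - 1) powr b"

text \<open>
  Square of 2 near the right end point, and square of \<open>2 * (x - 1) powr (b - 1)\<close>, the size of the
  derivative of a power, far from it. It is integrable at infinity exactly when \<open>b < 1 / 2\<close>,
  that is, \<open>\<alpha> < 2\<close>.
\<close>

definition kernel_majorant :: "real \<Rightarrow> real \<Rightarrow> real" where
  "kernel_majorant b x = indicator {0..2} x * 4 + indicator {2..} x * (4 * (x - 1) powr (2 * b - 2))"

lemma hadamard_increment_kernel_measurable [measurable]:
  "hadamard_increment_kernel b k \<in> borel_measurable borel"
  unfolding hadamard_increment_kernel_def[abs_def] by measurable

lemma fbm_increment_kernel_measurable [measurable]:
  "fbm_increment_kernel b \<in> borel_measurable borel"
  unfolding fbm_increment_kernel_def[abs_def] by measurable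

lemma hadamard_kernel_scaled:
  assumes "0 < h"
  shows "hadamard_kernel \<alpha> (h * k) (h * k + - h * x) - hadamard_kernel \<alpha> (h * (k - 1)) (h * k + - h * x)
    = hadamard_increment_kernel ((\<alpha> - 1) / 2) k x"
proof -
  have s: "h * k + - h * x = h * (k - x)" by (simp add: algebra_simps)
  have "0 < h * (k - x) \<longleftrightarrow> x < k" "h * (k - x) < h * k \<longleftrightarrow> 0 < x"
    "h * (k - x) < h * (k - 1) \<longleftrightarrow> 1 < x"
    using assms by (auto simp: zero_less_mult_iff)
  moreover have "h * k / (h * (k - x)) = k / (k - x)" "h * (k - 1) / (h * (k - x)) = (k - 1) / (k - x)"
    using assms by auto
  ultimately show ?thesis
    unfolding hadamard_kernel_def hadamard_increment_kernel_def s
    by (auto split: split_indicator)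
qed

text \<open>
  Self-similarity: the substitution \<open>s = h * (k - x)\<close> leaves the quotient of times in the kernel
  unchanged, so the mesh \<open>h\<close> enters only through the Jacobian.
\<close>

lemma hadamard_kernel_increment_L2:
  assumes "0 < h"
  shows "(\<integral>s. (hadamard_kernel \<alpha> (h * k) s - hadamard_kernel \<alpha> (h * (k - 1)) s)\<^sup>2 \<partial>lborel)
    = h * (\<integral>x. (hadamard_increment_kernel ((\<alpha> - 1) / 2) k x)\<^sup>2 \<partial>lborel)"
  using assms
  by (subst lborel_integral_real_affine[where c = "- h" and t = "h * k"])
    (simp_all only: hadamard_kernel_scaled, auto)

lemma kernel_majorant_integrable:
  assumes "0 < b" "b < 1 / 2"
  shows "integrable lborel (kernel_majorant b)"
proof -
  have int1: "integrable lborel (\<lambda>x::real. indicator {0..2} x * (4::real))"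
    by (intro integrable_mult_left) (simp add: integrable_indicator_iff)
  \<comment> \<open>The antiderivative of the tail that vanishes at infinity.\<close>
  define F where "F = (\<lambda>x::real. - 4 / (1 - 2 * b) * (x - 1) powr (2 * b - 1))"
  have "(\<integral>\<^sup>+x. ennreal (4 * (x - 1) powr (2 * b - 2)) * indicator {2..} x \<partial>lborel) = ennreal (0 - F 2)"
  proof (rule nn_integral_FTC_atLeast)
    show "(\<lambda>x. 4 * (x - 1) powr (2 * b - 2)) \<in> borel_measurable borel" by measurable
    show "(F has_real_derivative 4 * (x - 1) powr (2 * b - 2)) (at x)" if "2 \<le> x" for x
    proof -
      have "((\<lambda>x. (x - 1) powr (2 * b - 1)) has_real_derivative
          (2 * b - 1) * (x - 1) powr (2 * b - 1 - of_nat 1) * 1) (at x)"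
        using that by (intro DERIV_fun_powr) (auto intro!: derivative_eq_intros)
      moreover have "- 4 / (1 - 2 * b) * ((2 * b - 1) * (x - 1) powr (2 * b - 1 - of_nat 1) * 1)
          = 4 * (x - 1) powr (2 * b - 2)"
      proof -
        have "- 4 / (1 - 2 * b) * (2 * b - 1) = 4" using assms by (simp add: divide_simps)
        then show ?thesis by (simp add: mult.assoc[symmetric])
      qed
      ultimately show ?thesis
        unfolding F_def using DERIV_cmult[of _ _ x UNIV "- 4 / (1 - 2 * b)"] by metis
    qed
    show "0 \<le> 4 * (x - 1) powr (2 * b - 2)" for x :: real by simp
    show "(F \<longlongrightarrow> 0) at_top"
      unfolding F_def using assms by real_asymp
  qed
  then have "(\<integral>\<^sup>+x. ennreal (indicator {2..} x * (4 * (x - 1) powr (2 * b - 2))) \<partial>lborel) < \<infinity>"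
    by (subst (asm) nn_integral_cong[where v = "\<lambda>x. ennreal (indicator {2..} x * (4 * (x - 1) powr (2 * b - 2)))"])
      (auto split: split_indicator)
  then have "integrable lborel (\<lambda>x. indicator {2..} x * (4 * (x - 1) powr (2 * b - 2)))"
    by (intro integrableI_nonneg) auto
  with int1 show ?thesis unfolding kernel_majorant_def[abs_def] by (rule Bochner_Integration.integrable_add)
qed

text \<open>
  For \<open>1 < x\<close> write the kernel as \<open>u powr b - v powr b\<close>, where \<open>u\<close> and \<open>v\<close> are the two logarithms. From
  \<open>ln y \<le> y - 1\<close> one gets \<open>u - v \<le> 1 / (k - 1)\<close> and \<open>(x - 1) / (k - 1) \<le> v\<close>. Near the right end
  point Hoelder continuity of the power suffices; further away \<open>powr_diff_le_mult_diff\<close> gives the decay.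
  The mismatch between \<open>k\<close> and \<open>k - 1\<close> costs a factor of at most 2.
\<close>

lemma scaled_kernel_bound:
  fixes b k x :: real
  assumes b: "0 < b" "b < 1 / 2" and k: "2 \<le> k"
  shows "(k powr b * hadamard_increment_kernel b k x)\<^sup>2 \<le> kernel_majorant b x"
proof -
  have two: "(k / (k - 1)) powr b \<le> 2"
  proof -
    have "(k / (k - 1)) powr b \<le> 2 powr b"
      using k b by (intro powr_mono2) (auto simp: field_simps)
    also have "\<dots> \<le> 2 powr 1" using b by (intro powr_mono) auto
    finally show ?thesis by simp
  qed
  have scale: "k powr b * (y / (k - 1)) powr b \<le> 2 * y powr b" if "0 \<le> y" for y
  proof -
    have "k powr b * (y / (k - 1)) powr b = (k / (k - 1)) powr b * y powr b"
      using k that by (simp add: powr_divide)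
    also have "\<dots> \<le> 2 * y powr b" using two by (intro mult_right_mono) auto
    finally show ?thesis .
  qed
  have ln_le: "ln y \<le> y - 1" if "0 < y" for y :: real using that by (rule ln_le_minus_one)
  consider "x \<le> 0 \<or> k \<le> x" | "0 < x" "x \<le> 1" | "1 < x" "x < k" by linarith
  then show ?thesis
  proof cases
    case 1
    then have "hadamard_increment_kernel b k x = 0"
      unfolding hadamard_increment_kernel_def by (auto split: split_indicator)
    then show ?thesis by (simp add: kernel_majorant_def)
  next
    case 2
    have eq: "hadamard_increment_kernel b k x = ln (k / (k - x)) powr b"
      using 2 k unfolding hadamard_increment_kernel_def by auto
    have "ln (k / (k - x)) \<le> x / (k - x)"
      using ln_le[of "k / (k - x)"] 2 k by (simp add: field_simps)
    also have "\<dots> \<le> 1 / (k - 1)" using 2 k by (intro frac_le) auto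
    finally have "ln (k / (k - x)) powr b \<le> (1 / (k - 1)) powr b"
      using 2 k b by (intro powr_mono2) auto
    then have "k powr b * ln (k / (k - x)) powr b \<le> k powr b * (1 / (k - 1)) powr b"
      by (intro mult_left_mono) auto
    also have "\<dots> \<le> 2" using scale[of 1] by simp
    finally have "(k powr b * ln (k / (k - x)) powr b)\<^sup>2 \<le> 2\<^sup>2" by (intro power_mono) auto
    moreover have "kernel_majorant b x = 4" using 2 unfolding kernel_majorant_def by simp
    ultimately show ?thesis unfolding eq by simp
  next
    case 3
    define u where "u = ln (k / (k - x))"
    define v where "v = ln ((k - 1) / (k - x))"
    have eq: "hadamard_increment_kernel b k x = u powr b - v powr b"
      using 3 k unfolding hadamard_increment_kernel_def u_def v_def by auto
    have v_ge: "(x - 1) / (k - 1) \<le> v"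
    proof -
      have "- v = ln ((k - x) / (k - 1))" using 3 k unfolding v_def by (simp add: ln_div)
      also have "\<dots> \<le> (k - x) / (k - 1) - 1" using 3 k by (intro ln_le) auto
      also have "\<dots> = - ((x - 1) / (k - 1))" using k by (simp add: field_simps)
      finally show ?thesis by simp
    qed
    have v_pos: "0 < v" using v_ge 3 k by (smt (verit) divide_pos_pos)
    have uv: "u - v \<le> 1 / (k - 1)"
    proof -
      have "u - v = ln (k / (k - 1))" using 3 k unfolding u_def v_def by (simp add: ln_div)
      also have "\<dots> \<le> k / (k - 1) - 1" using k by (intro ln_le) auto
      also have "\<dots> = 1 / (k - 1)" using k by (simp add: field_simps)
      finally show ?thesis .
    qed
    have vu: "v \<le> u" using 3 k unfolding u_def v_def by (simp add: divide_right_mono)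
    have nonneg: "0 \<le> k powr b * (u powr b - v powr b)"
      using v_pos vu b by (intro mult_nonneg_nonneg) (auto intro: powr_mono2)
    show ?thesis
    proof (cases "x < 2")
      case True
      have "k powr b * (u powr b - v powr b) \<le> k powr b * (1 / (k - 1)) powr b"
      proof (intro mult_left_mono)
        have "u powr b - v powr b \<le> (u - v) powr b"
          using v_pos vu b by (intro powr_diff_le_powr) auto
        also have "\<dots> \<le> (1 / (k - 1)) powr b" using uv vu b by (intro powr_mono2) auto
        finally show "u powr b - v powr b \<le> (1 / (k - 1)) powr b" .
      qed auto
      also have "\<dots> \<le> 2" using scale[of 1] by simp
      finally have "(k powr b * (u powr b - v powr b))\<^sup>2 \<le> 2\<^sup>2" using nonneg by (intro power_mono)
      moreover have "kernel_majorant b x = 4" using 3 True unfolding kernel_majorant_def by simp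
      ultimately show ?thesis unfolding eq by simp
    next
      case False
      define y where "y = x - 1"
      have y: "1 \<le> y" using False unfolding y_def by simp
      have "u powr b - v powr b \<le> v powr (b - 1) * (u - v)"
        using v_pos vu b by (intro powr_diff_le_mult_diff) auto
      also have "\<dots> \<le> (y / (k - 1)) powr (b - 1) * (1 / (k - 1))"
        using v_ge vu uv y k b unfolding y_def[symmetric]
        by (intro mult_mono powr_mono2') auto
      also have "\<dots> = (y / (k - 1)) powr b / y"
        using y k by (simp add: powr_diff field_simps)
      finally have "u powr b - v powr b \<le> (y / (k - 1)) powr b / y" .
      from mult_left_mono[OF this, of "k powr b"]
      have "k powr b * (u powr b - v powr b) \<le> k powr b * (y / (k - 1)) powr b / y" by simp
      also have "\<dots> \<le> 2 * y powr b / y" using scale[of y] y by (intro divide_right_mono) auto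
      also have "\<dots> = 2 * y powr (b - 1)" using y by (simp add: powr_diff)
      finally have "(k powr b * (u powr b - v powr b))\<^sup>2 \<le> (2 * y powr (b - 1))\<^sup>2"
        using nonneg by (intro power_mono)
      also have "\<dots> = 4 * y powr (2 * b - 2)"
        using y by (simp add: power_mult_distrib power2_eq_square powr_add[symmetric])
      also have "\<dots> \<le> kernel_majorant b x"
        using False unfolding kernel_majorant_def y_def by (auto split: split_indicator)
      finally show ?thesis unfolding eq .
    qed
  qed
qed

text \<open>
  The power \<open>k powr b\<close> is absorbed into the logarithms: \<open>k * ln (k / (k - x))\<close> tends to \<open>x\<close> and
  \<open>k * ln ((k - 1) / (k - x))\<close> tends to \<open>x - 1\<close>.
\<close>

lemma scaled_kernel_tendsto:
  assumes "0 < b"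
  shows "(\<lambda>k. real k powr b * hadamard_increment_kernel b (real k) x) \<longlonglongrightarrow> fbm_increment_kernel b x"
proof (cases "0 < x")
  case False
  then show ?thesis
    by (simp add: hadamard_increment_kernel_def fbm_increment_kernel_def)
next
  case True
  have ev: "\<forall>\<^sub>F k in sequentially. max 1 x < real k"
    using filterlim_at_top_dense[THEN iffD1, OF filterlim_real_sequentially] by blast
  have "(\<lambda>k. real k * ln (real k / (real k - x))) \<longlonglongrightarrow> x" by real_asymp
  then have lim1: "(\<lambda>k. (real k * ln (real k / (real k - x))) powr b) \<longlonglongrightarrow> x powr b"
    using True by (intro tendsto_powr tendsto_const) auto
  have lim2_base: "(\<lambda>k. real k * ln ((real k - 1) / (real k - x))) \<longlonglongrightarrow> x - 1" by real_asymp
  have lim2: "(\<lambda>k. if 1 < x then (real k * ln ((real k - 1) / (real k - x))) powr b else 0)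
      \<longlonglongrightarrow> max 0 (x - 1) powr b"
  proof (cases "1 < x")
    case True
    then have "(\<lambda>k. (real k * ln ((real k - 1) / (real k - x))) powr b) \<longlonglongrightarrow> (x - 1) powr b"
      by (intro tendsto_powr lim2_base tendsto_const) auto
    with True show ?thesis by simp
  qed simp
  from tendsto_diff[OF lim1 lim2] have lim: "(\<lambda>k. (real k * ln (real k / (real k - x))) powr b
      - (if 1 < x then (real k * ln ((real k - 1) / (real k - x))) powr b else 0))
      \<longlonglongrightarrow> fbm_increment_kernel b x"
    using True by (simp add: fbm_increment_kernel_def)
  show ?thesis
  proof (rule Lim_transform_eventually[OF lim])
    show "\<forall>\<^sub>F k in sequentially. (real k * ln (real k / (real k - x))) powr b
      - (if 1 < x then (real k * ln ((real k - 1) / (real k - x))) powr b else 0)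
      = real k powr b * hadamard_increment_kernel b (real k) x"
      using ev
    proof eventually_elim
      case (elim k)
      then show ?case
        using True unfolding hadamard_increment_kernel_def
        by (auto simp: powr_mult right_diff_distrib split: split_indicator)
    qed
  qed
qed

text \<open>
  Dominated convergence along \<open>k \<ge> 2\<close>. The limit is positive because the limiting kernel is
  \<open>x powr b\<close> on the unit interval.
\<close>

lemma hadamard_increment_L2_asymptotics:
  assumes b: "0 < b" "b < 1 / 2"
  shows "(\<lambda>k. real k powr (2 * b) * (\<integral>x. (hadamard_increment_kernel b (real k) x)\<^sup>2 \<partial>lborel))
      \<longlonglongrightarrow> (\<integral>x. (fbm_increment_kernel b x)\<^sup>2 \<partial>lborel)" (is ?lim)
    and "0 < (\<integral>x. (fbm_increment_kernel b x)\<^sup>2 \<partial>lborel)" (is ?pos)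
proof -
  \<comment> \<open>The index shift provides \<open>k \<ge> 2\<close>, which the majorant requires.\<close>
  define G where "G = (\<lambda>k x. (real (k + 2) powr b * hadamard_increment_kernel b (real (k + 2)) x)\<^sup>2)"
  have meas [measurable]: "G k \<in> borel_measurable lborel" for k unfolding G_def by measurable
  have meas' [measurable]: "(\<lambda>x. (fbm_increment_kernel b x)\<^sup>2) \<in> borel_measurable lborel" by measurable
  have lim: "AE x in lborel. (\<lambda>k. G k x) \<longlonglongrightarrow> (fbm_increment_kernel b x)\<^sup>2"
    unfolding G_def by (intro AE_I2 tendsto_power LIMSEQ_ignore_initial_segment scaled_kernel_tendsto b)
  have bound: "AE x in lborel. norm (G k x) \<le> kernel_majorant b x" for k
    unfolding G_def using scaled_kernel_bound[OF b, of "real (k + 2)"] by (intro AE_I2) simp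
  have "(\<lambda>k. \<integral>x. G k x \<partial>lborel) \<longlonglongrightarrow> (\<integral>x. (fbm_increment_kernel b x)\<^sup>2 \<partial>lborel)"
    by (rule integral_dominated_convergence[OF meas' meas kernel_majorant_integrable[OF b] lim bound])
  moreover have "(\<integral>x. G k x \<partial>lborel) = real (k + 2) powr (2 * b)
      * (\<integral>x. (hadamard_increment_kernel b (real (k + 2)) x)\<^sup>2 \<partial>lborel)" for k
    unfolding G_def by (simp add: power_mult_distrib powr_power mult.commute)
  ultimately show ?lim by (simp only: LIMSEQ_offset[where k = 2])
  have int: "integrable lborel (\<lambda>x. (fbm_increment_kernel b x)\<^sup>2)"
    by (rule integrable_dominated_convergence[OF meas' meas kernel_majorant_integrable[OF b] lim bound])
  have "0 < (1 / 2) powr b * (1 / 2) powr b * (1 / 2 :: real)" by simp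
  also have "\<dots> = (\<integral>x. ((1 / 2) powr b * (1 / 2) powr b) * indicator {1/2..1::real} x \<partial>lborel)"
    by simp
  also have "\<dots> \<le> (\<integral>x. (fbm_increment_kernel b x)\<^sup>2 \<partial>lborel)"
  proof (rule integral_mono)
    show "integrable lborel (\<lambda>x. ((1 / 2) powr b * (1 / 2) powr b) * indicator {1/2..1::real} x)"
      by (intro integrable_mult_right integrable_real_indicator emeasure_bounded_finite) auto
    show "((1 / 2) powr b * (1 / 2) powr b) * indicator {1/2..1::real} x \<le> (fbm_increment_kernel b x)\<^sup>2" for x
    proof (cases "x \<in> {1/2..1}")
      case True
      then have "(1 / 2) powr b \<le> fbm_increment_kernel b x"
        unfolding fbm_increment_kernel_def using b by (auto intro: powr_mono2)
      then show ?thesis using True by (simp add: power2_eq_square mult_mono')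
    qed simp
  qed (rule int)
  finally show ?pos .
qed

section \<open>Power sums of a regularly decaying sequence\<close>

text \<open>
  With \<open>d = s - l * b\<close>, the increments of \<open>d\<close> are eventually at most \<open>e\<close> times those of \<open>b\<close>. Summing
  them bounds \<open>d\<close> by a constant plus \<open>e * b\<close>, and the constant is negligible since \<open>b\<close> diverges.
\<close>

lemma stolz_cesaro:
  fixes s b :: "nat \<Rightarrow> real"
  assumes mono: "\<And>n. b n < b (Suc n)" and inf: "filterlim b at_top sequentially"
    and lim: "(\<lambda>n. (s (Suc n) - s n) / (b (Suc n) - b n)) \<longlonglongrightarrow> l"
  shows "(\<lambda>n. s n / b n) \<longlonglongrightarrow> l"
proof (rule LIMSEQ_I)
  fix r :: real assume r: "0 < r"
  \<comment> \<open>One half of the error is spent on the increments, the other on the initial value \<open>d N\<close>.\<close>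
  define e where "e = r / 2"
  have e: "0 < e" using r unfolding e_def by simp
  define d where "d = (\<lambda>n. s n - l * b n)"
  have "\<forall>\<^sub>F n in sequentially. dist ((s (Suc n) - s n) / (b (Suc n) - b n)) l < e"
    using tendstoD[OF lim e] .
  moreover have "\<forall>\<^sub>F n in sequentially. 0 \<le> b n"
    using inf by (simp add: filterlim_at_top)
  ultimately obtain N where N: "\<And>n. N \<le> n \<Longrightarrow> \<bar>(s (Suc n) - s n) / (b (Suc n) - b n) - l\<bar> < e"
    "0 \<le> b N"
    unfolding eventually_sequentially dist_real_def by (metis nle_le order.trans)
  have step: "\<bar>d (Suc n) - d n\<bar> \<le> e * (b (Suc n) - b n)" if "N \<le> n" for n
  proof -
    have pos: "0 < b (Suc n) - b n" using mono[of n] by simp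
    then have "d (Suc n) - d n = ((s (Suc n) - s n) / (b (Suc n) - b n) - l) * (b (Suc n) - b n)"
      unfolding d_def by (simp add: field_simps)
    then have "\<bar>d (Suc n) - d n\<bar> = \<bar>(s (Suc n) - s n) / (b (Suc n) - b n) - l\<bar> * (b (Suc n) - b n)"
      using pos by (simp add: abs_mult)
    also have "\<dots> \<le> e * (b (Suc n) - b n)"
      using N(1)[OF that] pos by (intro mult_right_mono) auto
    finally show ?thesis .
  qed
  have bound: "\<bar>d n\<bar> \<le> \<bar>d N\<bar> + e * (b n - b N)" if "N \<le> n" for n
    using that
  proof (induction rule: dec_induct)
    case (step n)
    then show ?case using \<open>\<And>n. N \<le> n \<Longrightarrow> \<bar>d (Suc n) - d n\<bar> \<le> _\<close>[of n] by (simp add: algebra_simps)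
  qed simp
  have "\<forall>\<^sub>F n in sequentially. \<bar>d N\<bar> / e < b n"
    using inf by (simp add: filterlim_at_top_dense)
  then obtain N' where N': "\<And>n. N' \<le> n \<Longrightarrow> \<bar>d N\<bar> / e < b n"
    unfolding eventually_sequentially by blast
  have "norm (s n / b n - l) < r" if "max N N' \<le> n" for n
  proof -
    have dN: "\<bar>d N\<bar> < e * b n" using N'[of n] that e by (simp add: field_simps)
    then have pos: "0 < b n" using e by (smt (verit) zero_less_mult_pos)
    have "\<bar>d n\<bar> \<le> \<bar>d N\<bar> + e * (b n - b N)" using that by (intro bound) simp
    also have "\<dots> < e * b n + e * b n" using dN mult_nonneg_nonneg[OF less_imp_le[OF e] N(2)] unfolding right_diff_distrib by linarith
    also have "\<dots> = r * b n" unfolding e_def by simp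
    finally have "\<bar>d n\<bar> < r * b n" .
    moreover have "s n / b n - l = d n / b n" using pos unfolding d_def by (simp add: field_simps)
    ultimately show ?thesis using pos by (simp add: field_simps)
  qed
  then show "\<exists>no. \<forall>n\<ge>no. norm (s n / b n - l) < r" by blast
qed

text \<open>
  Pulling out \<open>n\<close> leaves \<open>s n / n powr q\<close> with \<open>q = 1 / \<alpha>\<close>. By the Stolz-Cesaro theorem it suffices to compare
  the last summand, of order \<open>n powr (q - 1)\<close>, with the increment of \<open>n powr q\<close>, asymptotically
  \<open>q * n powr (q - 1)\<close>.
\<close>

lemma critical_power_sum:
  fixes v :: "nat \<Rightarrow> real" and \<alpha> C :: real
  assumes \<alpha>: "1 < \<alpha>" and v: "\<And>k. 0 \<le> v k"
    and C: "0 < C" "(\<lambda>k. real k powr (\<alpha> - 1) * v k) \<longlonglongrightarrow> C"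
  shows "(\<lambda>n. \<Sum>k=1..n. (v k / real n) powr (1 / \<alpha>)) \<longlonglongrightarrow> \<alpha> * C powr (1 / \<alpha>)"
proof -
  define q where "q = 1 / \<alpha>"
  have q: "0 < q" "q < 1" "(\<alpha> - 1) * q = 1 - q" "\<alpha> = inverse q"
    using \<alpha> unfolding q_def by (auto simp: field_simps)
  define s where "s = (\<lambda>n. \<Sum>k=1..n. v k powr q)"
  have "(\<lambda>n. s n / real n powr q) \<longlonglongrightarrow> C powr q * inverse q"
  proof (rule stolz_cesaro)
    show "real n powr q < real (Suc n) powr q" for n using q by (intro powr_less_mono2) auto
    show "filterlim (\<lambda>n. real n powr q) at_top sequentially" using q(1) by real_asymp
    have l1: "(\<lambda>n. (real (Suc n) powr (\<alpha> - 1) * v (Suc n)) powr q) \<longlonglongrightarrow> C powr q"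
      using C(1) by (intro tendsto_powr[OF LIMSEQ_Suc[OF C(2)] tendsto_const]) simp
    have "(\<lambda>n. ((real n + 1) powr q - real n powr q) / (real n + 1) powr (q - 1)) \<longlonglongrightarrow> q"
      using q(1,2) by real_asymp
    from tendsto_inverse[OF this]
    have l2: "(\<lambda>n. (real n + 1) powr (q - 1) / ((real n + 1) powr q - real n powr q)) \<longlonglongrightarrow> inverse q"
      using q(1) by simp
    have eq: "(s (Suc n) - s n) / (real (Suc n) powr q - real n powr q)
      = (real (Suc n) powr (\<alpha> - 1) * v (Suc n)) powr q
        * ((real n + 1) powr (q - 1) / ((real n + 1) powr q - real n powr q))" for n
    proof -
      have "(real (Suc n) powr (\<alpha> - 1) * v (Suc n)) powr q * (real n + 1) powr (q - 1)
          = v (Suc n) powr q * ((real n + 1) powr ((\<alpha> - 1) * q) * (real n + 1) powr (q - 1))"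
        using v by (simp add: powr_mult powr_powr add.commute)
      also have "\<dots> = v (Suc n) powr q"
        unfolding q(3) by (simp add: powr_add[symmetric])
      finally show ?thesis unfolding s_def by (simp add: add.commute)
    qed
    show "(\<lambda>n. (s (Suc n) - s n) / (real (Suc n) powr q - real n powr q)) \<longlonglongrightarrow> C powr q * inverse q"
      unfolding eq by (rule tendsto_mult[OF l1 l2])
  qed
  moreover have "(\<Sum>k=1..n. (v k / real n) powr q) = s n / real n powr q" for n
    unfolding s_def using v by (simp add: powr_divide sum_divide_distrib)
  ultimately show ?thesis using q(4) unfolding q_def[symmetric] by (simp add: mult.commute)
qed

lemma scaled_terms_bounded:
  fixes v :: "nat \<Rightarrow> real" and \<gamma> C :: real
  assumes "0 \<le> \<gamma>" and v: "\<And>k. 0 \<le> v k" and lim: "(\<lambda>k. real k powr \<gamma> * v k) \<longlonglongrightarrow> C"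
  obtains K where "0 < K" "\<And>k. 1 \<le> k \<Longrightarrow> v k \<le> K"
proof -
  from lim have "Bseq (\<lambda>k. real k powr \<gamma> * v k)" by (intro convergent_imp_Bseq convergentI)
  then obtain K where K: "0 < K" "\<And>k. norm (real k powr \<gamma> * v k) \<le> K" by (auto elim: BseqE)
  have "v k \<le> K" if "1 \<le> k" for k
  proof -
    have "1 * v k \<le> real k powr \<gamma> * v k"
      using that assms(1) v by (intro mult_right_mono ge_one_powr_ge_zero) auto
    also have "\<dots> \<le> K" using K(2)[of k] by simp
    finally show ?thesis by simp
  qed
  with K(1) show thesis by (rule that)
qed

text \<open>
  Split off the critical exponent: each summand is its critical counterpart times
  \<open>(v k / n) powr (p / 2 - 1 / \<alpha>)\<close>, and \<open>v k / n \<le> K / n\<close> bounds this factor from above or from below,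
  according to the sign of the exponent.
\<close>

lemma noncritical_power_sum:
  fixes v :: "nat \<Rightarrow> real" and \<alpha> C p :: real
  assumes \<alpha>: "1 < \<alpha>" and v: "\<And>k. 0 \<le> v k"
    and C: "0 < C" "(\<lambda>k. real k powr (\<alpha> - 1) * v k) \<longlonglongrightarrow> C"
  shows "p > 2 / \<alpha> \<Longrightarrow> (\<lambda>n. \<Sum>k=1..n. (v k / real n) powr (p / 2)) \<longlonglongrightarrow> 0" (is "_ \<Longrightarrow> ?zero")
    and "p < 2 / \<alpha> \<Longrightarrow> filterlim (\<lambda>n. \<Sum>k=1..n. (v k / real n) powr (p / 2)) at_top sequentially"
      (is "_ \<Longrightarrow> ?top")
proof -
  define q where "q = 1 / \<alpha>"
  have q: "0 < q" using \<alpha> unfolding q_def by simp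
  define S where "S = (\<lambda>n. \<Sum>k=1..n. (v k / real n) powr q)"
  have S: "S \<longlonglongrightarrow> \<alpha> * C powr q"
    using critical_power_sum[OF \<alpha> v C] unfolding S_def q_def .
  obtain K where K: "0 < K" "\<And>k. 1 \<le> k \<Longrightarrow> v k \<le> K"
    using scaled_terms_bounded[OF _ v C(2)] \<alpha> by auto
  have split: "(v k / real n) powr (p / 2) = (v k / real n) powr q * (v k / real n) powr (p / 2 - q)" for k n
    by (simp add: powr_add[symmetric])
  have le: "v k / real n \<le> K / real n" if "1 \<le> k" for k n
    using K(2)[OF that] by (intro divide_right_mono) auto
  show ?zero if "p > 2 / \<alpha>"
  proof -
    have pq: "0 < p / 2 - q" using that unfolding q_def by (simp add: field_simps)
    show ?thesis
    proof (rule tendsto_sandwich[where f = "\<lambda>_. 0" and h = "\<lambda>n. S n * (K / real n) powr (p / 2 - q)"])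
      have "(\<lambda>n. (K / real n) powr (p / 2 - q)) \<longlonglongrightarrow> 0" using pq K(1) by real_asymp
      from tendsto_mult[OF S this] show "(\<lambda>n. S n * (K / real n) powr (p / 2 - q)) \<longlonglongrightarrow> 0" by simp
      have "(\<Sum>k=1..n. (v k / real n) powr (p / 2)) \<le> S n * (K / real n) powr (p / 2 - q)" for n
        unfolding S_def sum_distrib_right split using pq v
        by (intro sum_mono mult_left_mono powr_mono2 le) auto
      then show "\<forall>\<^sub>F n in sequentially. (\<Sum>k=1..n. (v k / real n) powr (p / 2))
          \<le> S n * (K / real n) powr (p / 2 - q)" by simp
    qed (auto intro!: always_eventually sum_nonneg)
  qed
  show ?top if "p < 2 / \<alpha>"
  proof -
    have pq: "p / 2 - q < 0" using that unfolding q_def by (simp add: field_simps)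
    have "filterlim (\<lambda>n. (K / real n) powr (p / 2 - q)) at_top sequentially" using pq K(1) by real_asymp
    then have top: "filterlim (\<lambda>n. S n * (K / real n) powr (p / 2 - q)) at_top sequentially"
      using \<alpha> C(1) by (intro filterlim_tendsto_pos_mult_at_top[OF S]) auto
    have lower: "S n * (K / real n) powr (p / 2 - q) \<le> (\<Sum>k=1..n. (v k / real n) powr (p / 2))" for n
    proof -
      have "(v k / real n) powr q * (K / real n) powr (p / 2 - q) \<le> (v k / real n) powr (p / 2)"
        if k: "1 \<le> k" "k \<le> n" for k
      proof (cases "v k = 0")
        case False
        then have "0 < v k / real n" using v[of k] k by simp
        then show ?thesis unfolding split using pq le[OF k(1), of n]
          by (intro mult_left_mono powr_mono2') auto
      qed simp
      then show ?thesis unfolding S_def sum_distrib_right by (intro sum_mono) auto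
    qed
    show ?thesis by (rule filterlim_at_top_mono[OF top always_eventually[OF allI[OF lower]]])
  qed
qed

section \<open>Variations of the Hadamard fractional Brownian motion\<close>

text \<open>
  Time zero fits the same pattern: the kernel vanishes there, and so does its integral.
\<close>

lemma (in standard_brownian_motion) hadamard_fbm_is_wiener_integral:
  assumes X: "hadamard_fbm M B \<alpha> X" and t: "0 \<le> t"
  obtains I where "has_wiener_integral M B (hadamard_kernel \<alpha> t) I"
    "\<And>\<omega>. \<omega> \<in> space M \<Longrightarrow> X t \<omega> = 1 / sqrt (Gamma \<alpha>) * I \<omega>"
proof (cases "t = 0")
  case True
  have "hadamard_kernel \<alpha> 0 = (\<lambda>s. 0)" by (simp add: hadamard_kernel_def fun_eq_iff)
  then have "has_wiener_integral M B (hadamard_kernel \<alpha> 0) (\<lambda>_. 0)"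
    unfolding has_wiener_integral_def
    by (intro conjI exI[of _ "\<lambda>_. []"]) (simp_all add: step_list_def step_fun_def step_integral_def)
  then show thesis using that[of "\<lambda>_. 0"] X True unfolding hadamard_fbm_def by simp
next
  case False
  then show thesis using that X t unfolding hadamard_fbm_def by (metis less_eq_real_def)
qed

lemma (in standard_brownian_motion) hadamard_fbm_increment_abs_moment:
  assumes X: "hadamard_fbm M B \<alpha> X" and \<alpha>: "0 < \<alpha>" and h: "0 < h" and k: "1 \<le> k" and p: "0 < p"
  shows "(\<lambda>\<omega>. X (h * k) \<omega> - X (h * (k - 1)) \<omega>) \<in> borel_measurable M"
    and "(\<integral>\<^sup>+\<omega>. ennreal (\<bar>X (h * k) \<omega> - X (h * (k - 1)) \<omega>\<bar> powr p) \<partial>M)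
      = ennreal (normal_abs_moment p * (h / Gamma \<alpha> *
          (\<integral>x. (hadamard_increment_kernel ((\<alpha> - 1) / 2) k x)\<^sup>2 \<partial>lborel)) powr (p / 2))"
proof -
  define c where "c = 1 / sqrt (Gamma \<alpha>)"
  define D where "D = (\<integral>x. (hadamard_increment_kernel ((\<alpha> - 1) / 2) k x)\<^sup>2 \<partial>lborel)"
  have G: "0 < Gamma \<alpha>" using \<alpha> by simp
  have c: "0 \<le> c" unfolding c_def using G by simp
  obtain I where I: "has_wiener_integral M B (hadamard_kernel \<alpha> (h * k)) I"
    "\<And>\<omega>. \<omega> \<in> space M \<Longrightarrow> X (h * k) \<omega> = c * I \<omega>"
    unfolding c_def by (rule hadamard_fbm_is_wiener_integral[OF X, of "h * k"]) (use h k in auto)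
  obtain J where J: "has_wiener_integral M B (hadamard_kernel \<alpha> (h * (k - 1))) J"
    "\<And>\<omega>. \<omega> \<in> space M \<Longrightarrow> X (h * (k - 1)) \<omega> = c * J \<omega>"
    unfolding c_def by (rule hadamard_fbm_is_wiener_integral[OF X, of "h * (k - 1)"]) (use h k in auto)
  have [measurable]: "I \<in> borel_measurable M" "J \<in> borel_measurable M"
    using I(1) J(1) unfolding has_wiener_integral_def by auto
  have incr: "X (h * k) \<omega> - X (h * (k - 1)) \<omega> = c * (I \<omega> - J \<omega>)" if "\<omega> \<in> space M" for \<omega>
    using I(2)[OF that] J(2)[OF that] by (simp add: right_diff_distrib)
  show "(\<lambda>\<omega>. X (h * k) \<omega> - X (h * (k - 1)) \<omega>) \<in> borel_measurable M"
    by (subst measurable_cong[OF incr]) auto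
  have "(\<integral>\<^sup>+\<omega>. ennreal (\<bar>X (h * k) \<omega> - X (h * (k - 1)) \<omega>\<bar> powr p) \<partial>M)
      = (\<integral>\<^sup>+\<omega>. ennreal (c powr p) * ennreal (\<bar>I \<omega> - J \<omega>\<bar> powr p) \<partial>M)"
    using c by (intro nn_integral_cong) (simp add: incr abs_mult powr_mult ennreal_mult)
  also have "\<dots> = ennreal (c powr p) * (\<integral>\<^sup>+\<omega>. ennreal (\<bar>I \<omega> - J \<omega>\<bar> powr p) \<partial>M)"
    by (rule nn_integral_cmult) auto
  also have "(\<integral>\<^sup>+\<omega>. ennreal (\<bar>I \<omega> - J \<omega>\<bar> powr p) \<partial>M)
      = ennreal (normal_abs_moment p * (\<integral>s. (hadamard_kernel \<alpha> (h * k) s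
          - hadamard_kernel \<alpha> (h * (k - 1)) s)\<^sup>2 \<partial>lborel) powr (p / 2))"
    by (rule wiener_integral_abs_moment[OF has_wiener_integral_diff[OF I(1) J(1)] _ p])
      (simp add: hadamard_kernel_def)
  also have "\<dots> = ennreal (normal_abs_moment p * (h * D) powr (p / 2))"
    unfolding hadamard_kernel_increment_L2[OF h] D_def ..
  also have "ennreal (c powr p) * ennreal (normal_abs_moment p * (h * D) powr (p / 2))
      = ennreal (normal_abs_moment p * (c powr p * (h * D) powr (p / 2)))"
    by (simp add: ennreal_mult'[symmetric] mult_ac)
  also have "c powr p = (1 / Gamma \<alpha>) powr (p / 2)"
    unfolding c_def using G by (simp add: powr_half_sqrt[symmetric] powr_divide powr_powr)
  also have "(1 / Gamma \<alpha>) powr (p / 2) * (h * D) powr (p / 2) = (h / Gamma \<alpha> * D) powr (p / 2)"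
    using G h by (simp add: powr_mult[symmetric] D_def)
  finally show "(\<integral>\<^sup>+\<omega>. ennreal (\<bar>X (h * k) \<omega> - X (h * (k - 1)) \<omega>\<bar> powr p) \<partial>M)
      = ennreal (normal_abs_moment p * (h / Gamma \<alpha> *
          (\<integral>x. (hadamard_increment_kernel ((\<alpha> - 1) / 2) k x)\<^sup>2 \<partial>lborel)) powr (p / 2))"
    unfolding D_def .
qed

text \<open>
  With mesh \<open>h = T / n\<close>, self-similarity turns all the increment variances into multiples of \<open>h\<close>
  by numbers that depend on \<open>k\<close> alone.
\<close>

lemma (in standard_brownian_motion) hadamard_fbm_expected_power_sum:
  fixes n :: nat
  assumes X: "hadamard_fbm M B \<alpha> X" and \<alpha>: "0 < \<alpha>" and T: "0 < T" and n: "0 < n" and p: "0 < p"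
  shows "(\<integral>\<^sup>+\<omega>. ennreal (\<Sum>k = 1..n.
        \<bar>X (T * real k / real n) \<omega> - X (T * (real k - 1) / real n) \<omega>\<bar> powr p) \<partial>M)
    = ennreal (normal_abs_moment p * (T / Gamma \<alpha>) powr (p / 2) * (\<Sum>k = 1..n.
        ((\<integral>x. (hadamard_increment_kernel ((\<alpha> - 1) / 2) (real k) x)\<^sup>2 \<partial>lborel) / real n) powr (p / 2)))"
proof -
  define h where "h = T / real n"
  have h: "0 < h" using T n unfolding h_def by simp
  have times: "T * real k / real n = h * real k" "T * (real k - 1) / real n = h * (real k - 1)" for k :: nat
    unfolding h_def by simp_all
  define D where "D = (\<lambda>k::nat. \<integral>x. (hadamard_increment_kernel ((\<alpha> - 1) / 2) (real k) x)\<^sup>2 \<partial>lborel)"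
  have D: "0 \<le> D k" for k unfolding D_def by simp
  have G: "0 < Gamma \<alpha>" using \<alpha> by simp
  have scale: "(h / Gamma \<alpha> * D k) powr (p / 2)
      = (T / Gamma \<alpha>) powr (p / 2) * (D k / real n) powr (p / 2)" for k
  proof -
    have "h / Gamma \<alpha> * D k = (T / Gamma \<alpha>) * (D k / real n)" unfolding h_def by simp
    then show ?thesis using D[of k] T G by (simp only: powr_mult divide_nonneg_nonneg less_imp_le of_nat_0_le_iff)
  qed
  note moment = hadamard_fbm_increment_abs_moment[OF X \<alpha> h _ p]
  have "(\<integral>\<^sup>+\<omega>. ennreal (\<Sum>k = 1..n. \<bar>X (h * real k) \<omega> - X (h * (real k - 1)) \<omega>\<bar> powr p) \<partial>M)
      = (\<integral>\<^sup>+\<omega>. (\<Sum>k = 1..n. ennreal (\<bar>X (h * real k) \<omega> - X (h * (real k - 1)) \<omega>\<bar> powr p)) \<partial>M)"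
    by (simp add: sum_ennreal)
  also have "\<dots> = (\<Sum>k = 1..n. \<integral>\<^sup>+\<omega>. ennreal (\<bar>X (h * real k) \<omega> - X (h * (real k - 1)) \<omega>\<bar> powr p) \<partial>M)"
  proof (rule nn_integral_sum)
    fix k assume "k \<in> {1..n}"
    then have [measurable]: "(\<lambda>\<omega>. X (h * real k) \<omega> - X (h * (real k - 1)) \<omega>) \<in> borel_measurable M"
      by (intro moment(1)) auto
    show "(\<lambda>\<omega>. ennreal (\<bar>X (h * real k) \<omega> - X (h * (real k - 1)) \<omega>\<bar> powr p)) \<in> borel_measurable M"
      by measurable
  qed
  also have "\<dots> = (\<Sum>k = 1..n. ennreal (normal_abs_moment p * (h / Gamma \<alpha> * D k) powr (p / 2)))"
    unfolding D_def by (intro sum.cong refl moment(2)) auto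
  also have "\<dots> = ennreal (\<Sum>k = 1..n. normal_abs_moment p * (h / Gamma \<alpha> * D k) powr (p / 2))"
    using normal_abs_moment_pos[OF p] by (intro sum_ennreal) auto
  also have "\<dots> = ennreal (normal_abs_moment p * (T / Gamma \<alpha>) powr (p / 2)
      * (\<Sum>k = 1..n. (D k / real n) powr (p / 2)))"
    by (simp only: scale sum_distrib_left mult.assoc)
  finally show ?thesis unfolding times D_def .
qed

theorem theorem5p1:
  fixes M :: "'a measure"
    and B X :: "real \<Rightarrow> 'a \<Rightarrow> real"
    and \<alpha> T :: real
  assumes "standard_brownian_motion M B"
    and "1 < \<alpha>" and "\<alpha> < 2"
    and "hadamard_fbm M B \<alpha> X"
    and "0 < T"
  shows "(\<forall>p>0.
            (p = 2 / \<alpha> \<longrightarrow> (\<exists>v. 0 < v \<and> v < \<infinity> \<and> has_p_variation M X p T v)) \<and>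
            (p > 2 / \<alpha> \<longrightarrow> has_p_variation M X p T 0) \<and>
            (p < 2 / \<alpha> \<longrightarrow> has_p_variation M X p T \<infinity>)) \<and>
         has_p_variation M X 2 T 0"
proof -
  interpret standard_brownian_motion M B by (rule assms(1))
  note \<alpha> = \<open>1 < \<alpha>\<close> \<open>\<alpha> < 2\<close>
  define b where "b = (\<alpha> - 1) / 2"
  have b: "0 < b" "b < 1 / 2" "2 * b = \<alpha> - 1" using \<alpha> unfolding b_def by auto
  define D where "D = (\<lambda>k::nat. \<integral>x. (hadamard_increment_kernel b (real k) x)\<^sup>2 \<partial>lborel)"
  have D: "0 \<le> D k" for k unfolding D_def by simp
  define C where "C = (\<integral>x. (fbm_increment_kernel b x)\<^sup>2 \<partial>lborel)"
  have C: "0 < C" "(\<lambda>k. real k powr (\<alpha> - 1) * D k) \<longlonglongrightarrow> C"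
    using hadamard_increment_L2_asymptotics[OF b(1,2)] unfolding b(3) C_def D_def by auto
  define K where "K = (\<lambda>p. normal_abs_moment p * (T / Gamma \<alpha>) powr (p / 2))"
  have K: "0 < K p" if "0 < p" for p
  proof -
    have "0 < Gamma \<alpha>" using \<alpha> by simp
    then have "0 < (T / Gamma \<alpha>) powr (p / 2)" using \<open>0 < T\<close> by simp
    then show ?thesis unfolding K_def using normal_abs_moment_pos[OF that] by simp
  qed
  define V where "V = (\<lambda>p n. K p * (\<Sum>k=1..n. (D k / real n) powr (p / 2)))"
  have variation: "has_p_variation M X p T v" if "(\<lambda>n. ennreal (V p n)) \<longlonglongrightarrow> v" "0 < p" for p v
    unfolding has_p_variation_def
  proof (rule Lim_transform_eventually[OF that(1)])
    show "\<forall>\<^sub>F n in sequentially. ennreal (V p n) = (\<integral>\<^sup>+\<omega>. ennreal (\<Sum>k = 1..n.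
        \<bar>X (T * real k / real n) \<omega> - X (T * (real k - 1) / real n) \<omega>\<bar> powr p) \<partial>M)"
      using eventually_gt_at_top[of 0]
      by eventually_elim
        (use hadamard_fbm_expected_power_sum[OF assms(4) _ \<open>0 < T\<close> _ that(2)] \<alpha>
          in \<open>simp add: V_def K_def D_def b_def\<close>)
  qed
  have critical: "\<exists>v. 0 < v \<and> v < \<infinity> \<and> has_p_variation M X p T v" if p: "0 < p" "p = 2 / \<alpha>" for p
  proof -
    define v where "v = K p * (\<alpha> * C powr (1 / \<alpha>))"
    have "p / 2 = 1 / \<alpha>" using p by simp
    then have "V p \<longlonglongrightarrow> v"
      using tendsto_mult[OF tendsto_const critical_power_sum[OF \<alpha>(1) D C], of "K p"]
      unfolding V_def v_def by simp
    then have "has_p_variation M X p T (ennreal v)" by (intro variation tendsto_ennrealI p)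
    moreover have "0 < v" unfolding v_def using K[OF p(1)] \<alpha> C(1) by simp
    ultimately show ?thesis by (intro exI[of _ "ennreal v"]) simp
  qed
  have above: "has_p_variation M X p T 0" if p: "0 < p" "2 / \<alpha> < p" for p
  proof -
    have "V p \<longlonglongrightarrow> 0"
      using tendsto_mult[OF tendsto_const noncritical_power_sum(1)[OF \<alpha>(1) D C p(2)], of "K p"]
      unfolding V_def by simp
    from tendsto_ennrealI[OF this] show ?thesis by (intro variation p) simp
  qed
  have below: "has_p_variation M X p T \<infinity>" if p: "0 < p" "p < 2 / \<alpha>" for p
  proof -
    have "filterlim (V p) at_top sequentially"
      unfolding V_def using noncritical_power_sum(2)[OF \<alpha>(1) D C p(2)] K[OF p(1)]
      by (intro filterlim_tendsto_pos_mult_at_top[OF tendsto_const]) auto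
    then show ?thesis by (intro variation p) (simp add: ennreal_tendsto_top_eq_at_top)
  qed
  have "2 / \<alpha> < 2" using \<alpha> by (simp add: field_simps)
  with critical above below show ?thesis by auto
qed

end
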